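(* Let $f\in\mathcal{L}_{q,2}$ and let $c_n=\int_0^\infty \psi_n(y)f(y)\,d_qy$ ($n=0,1,2,\ldots$) be its Fourier coefficients with respect to the functions $\psi_n$. Then $$\int_0^\infty \{f(x)\}^2\,d_qx=\sum_{n=0}^\infty c_n^2 .$$
   Context: Fix $0<q<1$ and put $\mathbb{R}_q^+=\{q^n: n\in\mathbb{Z}\}$. For a function $f$ on $\mathbb{R}_q^+$, $\Lambda_q^{-1}f(x)=f(q^{-1}x)$, $D_qf(x)=\frac{f(x)-f(qx)}{(1-q)x}$, and $$\Delta_q f(x)=\frac1{x^2}\Big[f(q^{-1}x)-\frac{1+q}{q}f(x)+\frac1q f(qx)\Big].$$ Values at $0$ are limits along $\mathbb{R}_q^+$: $f(0)=\lim_{n\to\infty}f(q^n)$ and $f'(0)=\lim_{n\to\infty}\frac{f(q^n)-f(0)}{q^n}$. Jackson's integral is $\int_0^b f(x)\,d_qx=(1-q)\sum_{n\ge0}bq^nf(bq^n)$ for $b\in\mathbb{R}_q^+$, and $\int_0^\infty f(x)\,d_qx=(1-q)\sum_{n\in\mathbb{Z}}q^nf(q^n)$. $L^2(\mathbb{R}_q^+)$ is the Hilbert space of functions $f$ on $\mathbb{R}_q^+$ with $\int_0^\infty|f(x)|^2d_qx<\infty$. Potential and solutions: $x\mapsto q(x)$ is a given real-valued function on $\mathbb{R}_q^+$ (the symbol $q$ with an argument is this function; without argument it is the number $q$), and $Lf(x)=q(x)f(x)-\Delta_qf(x)$. Fix $\alpha\in\mathbb{R}$. It is assumed that for every $\lambda\in\mathbb{C}$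 the equation $\Delta_qf(x)+[\lambda-q(x)]f(x)=0$ on $\mathbb{R}_q^+$ has solutions $\phi(x)=\phi(x,\lambda)$ and $\theta(x)=\theta(x,\lambda)$ with $$\phi(0)=\tfrac{\sqrt q}{1-q}\sin\alpha,\quad \phi'(0)=-\tfrac{\sqrt q}{1-q}\cos\alpha,\quad \theta(0)=\tfrac{\sqrt q}{1-q}\cos\alpha,\quad \theta'(0)=\tfrac{\sqrt q}{1-q}\sin\alpha .$$ The $q$-Wronskian is $W_x(F,G)=\frac{(1-q)^2}{q}\big[F(x)\Lambda_q^{-1}D_qG(x)-G(x)\Lambda_q^{-1}D_qF(x)\big]$. Function $m$: for non-real $\lambda$, $b\in\mathbb{R}_q^+$ and $\beta\in\mathbb{R}$ let $$l(\lambda;b,\beta)=-\frac{\theta(b,\lambda)\cos\beta+\Lambda_q^{-1}D_q\theta(b,\lambda)\sin\beta}{\phi(b,\lambda)\cos\beta+\Lambda_q^{-1}D_q\phi(b,\lambda)\sin\beta}.$$ For fixed $\lambda,b$, as $\beta$ varies, $l$ describes a circle $C_b$; as $b\to\infty$ these nested circles converge to a limit-point or a limit-circle. $m(\lambda)$ is the limit-point, or a point of the limit-circle obtained as $m(\lambda)=\lim_j l(\lambda;b_j,\beta_j)$ with $b_j\to\infty$ in $\mathbb{R}_q^+$ and real $\beta_j$, the sequences $(b_j),(\beta_j)$ being the same for all non-real $\lambda$. Standing assumption: $m$ forms a single analytic function whose only singularities are poles on the real axis (they are then simple). Denote these poles by $\lambda_0,\lambda_1,\ldots$ and the residues by $r_0,r_1,\ldots$.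 Put $\psi(x,\lambda)=\theta(x,\lambda)+m(\lambda)\phi(x,\lambda)$ and $\psi_n(x)=\sqrt{r_n}\,\phi(x,\lambda_n)$. $\mathcal{L}_{q,2}$ is the space of all $f\in L^2(\mathbb{R}_q^+)$ such that: (i) $Lf\in L^2(\mathbb{R}_q^+)$; (ii) $f(0),f'(0)$ exist and $f(0)\cos\alpha+f'(0)\sin\alpha=0$; (iii) $\lim_{x\to\infty}W_x(\psi(\cdot,\lambda),f)=0$ for every non-real $\lambda$ (limit along $\mathbb{R}_q^+$). *)

theory Defs
  imports "HOL-Complex_Analysis.Complex_Analysis"
begin

text \<open>
  Functions on \<open>{q\<^sup>n | n \<in> \<int>}\<close> are represented by functions \<open>real \<Rightarrow> complex\<close>; every notion below
  only looks at their values on that set.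
\<close>

definition Rq :: "real \<Rightarrow> real set" where
  "Rq q = range (\<lambda>n::int. q powi n)"

definition q_shift_inv :: "real \<Rightarrow> (real \<Rightarrow> complex) \<Rightarrow> real \<Rightarrow> complex" where
  "q_shift_inv q f x = f (inverse q * x)"

definition q_deriv :: "real \<Rightarrow> (real \<Rightarrow> complex) \<Rightarrow> real \<Rightarrow> complex" where
  "q_deriv q f x = (f x - f (q * x)) / complex_of_real ((1 - q) * x)"

definition q_laplace :: "real \<Rightarrow> (real \<Rightarrow> complex) \<Rightarrow> real \<Rightarrow> complex" where
  "q_laplace q f x = complex_of_real (1 / x\<^sup>2) *
     (f (inverse q * x) - complex_of_real ((1 + q) / q) * f x + complex_of_real (1 / q) * f (q * x))"

text \<open>\<open>has_initial_values q f v d\<close>: the limits \<open>f(0)\<close> and \<open>f'(0)\<close> along the powers of \<open>q\<close>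
  exist and equal \<open>v\<close> and \<open>d\<close>; the number \<open>f 0\<close> itself plays no role.\<close>

definition has_initial_values :: "real \<Rightarrow> (real \<Rightarrow> complex) \<Rightarrow> complex \<Rightarrow> complex \<Rightarrow> bool" where
  "has_initial_values q f v d \<longleftrightarrow>
     (\<lambda>n. f (q ^ n)) \<longlonglongrightarrow> v \<and>
     (\<lambda>n. (f (q ^ n) - v) / complex_of_real (q ^ n)) \<longlonglongrightarrow> d"

definition jackson_integral :: "real \<Rightarrow> (real \<Rightarrow> complex) \<Rightarrow> complex" where
  "jackson_integral q f = complex_of_real (1 - q) *
     (\<Sum>\<^sub>\<infinity>n::int. complex_of_real (q powi n) * f (q powi n))"

definition L2q :: "real \<Rightarrow> (real \<Rightarrow> complex) set" where
  "L2q q = {f. (\<lambda>n::int. q powi n * (cmod (f (q powi n)))\<^sup>2) summable_on UNIV}"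

definition sturm_op :: "real \<Rightarrow> (real \<Rightarrow> real) \<Rightarrow> (real \<Rightarrow> complex) \<Rightarrow> real \<Rightarrow> complex" where
  "sturm_op q V f x = complex_of_real (V x) * f x - q_laplace q f x"

definition is_solution ::
    "real \<Rightarrow> (real \<Rightarrow> real) \<Rightarrow> complex \<Rightarrow> (real \<Rightarrow> complex) \<Rightarrow> bool" where
  "is_solution q V z f \<longleftrightarrow>
     (\<forall>x\<in>Rq q. q_laplace q f x + (z - complex_of_real (V x)) * f x = 0)"

definition q_wronskian ::
    "real \<Rightarrow> (real \<Rightarrow> complex) \<Rightarrow> (real \<Rightarrow> complex) \<Rightarrow> real \<Rightarrow> complex" where
  "q_wronskian q F G x = complex_of_real ((1 - q)\<^sup>2 / q) *
     (F x * q_shift_inv q (q_deriv q G) x - G x * q_shift_inv q (q_deriv q F) x)"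

text \<open>The families \<open>\<phi>\<close> and \<open>\<theta>\<close> take the spectral parameter as first argument:
  \<open>\<phi> z x\<close> is \<open>\<phi>(x, z)\<close>.\<close>

definition phi_family ::
    "real \<Rightarrow> (real \<Rightarrow> real) \<Rightarrow> real \<Rightarrow> (complex \<Rightarrow> real \<Rightarrow> complex) \<Rightarrow> bool" where
  "phi_family q V \<alpha> \<phi> \<longleftrightarrow>
     (\<forall>z. is_solution q V z (\<phi> z) \<and>
          has_initial_values q (\<phi> z)
            (complex_of_real (sqrt q / (1 - q) * sin \<alpha>))
            (complex_of_real (- (sqrt q / (1 - q)) * cos \<alpha>)))"

definition theta_family ::
    "real \<Rightarrow> (real \<Rightarrow> real) \<Rightarrow> real \<Rightarrow> (complex \<Rightarrow> real \<Rightarrow> complex) \<Rightarrow> bool" where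
  "theta_family q V \<alpha> \<theta> \<longleftrightarrow>
     (\<forall>z. is_solution q V z (\<theta> z) \<and>
          has_initial_values q (\<theta> z)
            (complex_of_real (sqrt q / (1 - q) * cos \<alpha>))
            (complex_of_real (sqrt q / (1 - q) * sin \<alpha>)))"

definition weyl_l ::
    "real \<Rightarrow> (complex \<Rightarrow> real \<Rightarrow> complex) \<Rightarrow> (complex \<Rightarrow> real \<Rightarrow> complex) \<Rightarrow>
     complex \<Rightarrow> real \<Rightarrow> real \<Rightarrow> complex" where
  "weyl_l q \<phi> \<theta> z b \<beta> =
     - ((\<theta> z b * complex_of_real (cos \<beta>) +
           q_shift_inv q (q_deriv q (\<theta> z)) b * complex_of_real (sin \<beta>)) /
        (\<phi> z b * complex_of_real (cos \<beta>) +
           q_shift_inv q (q_deriv q (\<phi> z)) b * complex_of_real (sin \<beta>)))"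

definition weyl_circle ::
    "real \<Rightarrow> (complex \<Rightarrow> real \<Rightarrow> complex) \<Rightarrow> (complex \<Rightarrow> real \<Rightarrow> complex) \<Rightarrow>
     complex \<Rightarrow> real \<Rightarrow> complex set" where
  "weyl_circle q \<phi> \<theta> z b = range (weyl_l q \<phi> \<theta> z b)"

definition weyl_limit_point ::
    "real \<Rightarrow> (complex \<Rightarrow> real \<Rightarrow> complex) \<Rightarrow> (complex \<Rightarrow> real \<Rightarrow> complex) \<Rightarrow>
     complex \<Rightarrow> complex \<Rightarrow> bool" where
  "weyl_limit_point q \<phi> \<theta> z \<mu> \<longleftrightarrow>
     (\<forall>e>0. \<exists>B. \<forall>b\<in>Rq q. b \<ge> B \<longrightarrow> weyl_circle q \<phi> \<theta> z b \<subseteq> ball \<mu> e)"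

text \<open>The sequences \<open>b\<close> and \<open>\<beta>\<close> are chosen before \<open>z\<close>. In the limit-circle case a limit of
  points of the circles \<open>C\<^sub>b\<close> automatically lies on the limit-circle.\<close>

definition weyl_m_function ::
    "real \<Rightarrow> (complex \<Rightarrow> real \<Rightarrow> complex) \<Rightarrow> (complex \<Rightarrow> real \<Rightarrow> complex) \<Rightarrow>
     (complex \<Rightarrow> complex) \<Rightarrow> bool" where
  "weyl_m_function q \<phi> \<theta> m \<longleftrightarrow>
     (\<exists>(b :: nat \<Rightarrow> real) (\<beta> :: nat \<Rightarrow> real).
        (\<forall>j. b j \<in> Rq q) \<and> filterlim b at_top sequentially \<and>
        (\<forall>z. z \<notin> \<real> \<longrightarrow>
           weyl_limit_point q \<phi> \<theta> z (m z) \<or>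
           (\<lambda>j. weyl_l q \<phi> \<theta> z (b j) (\<beta> j)) \<longlonglongrightarrow> m z))"

text \<open>The second conjunct excludes removable singularities, which \<open>meromorphic_on\<close> permits.\<close>

definition only_real_poles :: "(complex \<Rightarrow> complex) \<Rightarrow> bool" where
  "only_real_poles m \<longleftrightarrow>
     m meromorphic_on UNIV \<and>
     (\<forall>z. \<not> is_pole m z \<longrightarrow> m analytic_on {z}) \<and>
     (\<forall>z. is_pole m z \<longrightarrow> z \<in> \<real>)"

definition weyl_psi ::
    "(complex \<Rightarrow> real \<Rightarrow> complex) \<Rightarrow> (complex \<Rightarrow> real \<Rightarrow> complex) \<Rightarrow> (complex \<Rightarrow> complex) \<Rightarrow>
     complex \<Rightarrow> real \<Rightarrow> complex" where
  "weyl_psi \<phi> \<theta> m z x = \<theta> z x + m z * \<phi> z x"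

text \<open>The residue of \<open>m\<close> is of type \<open>complex\<close>; it is in fact positive at every pole, where
  \<open>csqrt\<close> is the usual square root.\<close>

definition eigenfun ::
    "(complex \<Rightarrow> real \<Rightarrow> complex) \<Rightarrow> (complex \<Rightarrow> complex) \<Rightarrow> (nat \<Rightarrow> complex) \<Rightarrow>
     nat \<Rightarrow> real \<Rightarrow> complex" where
  "eigenfun \<phi> m ev n x = csqrt (residue m (ev n)) * \<phi> (ev n) x"

definition Lq2_space ::
    "real \<Rightarrow> (real \<Rightarrow> real) \<Rightarrow> real \<Rightarrow> (complex \<Rightarrow> real \<Rightarrow> complex) \<Rightarrow>
     (complex \<Rightarrow> real \<Rightarrow> complex) \<Rightarrow> (complex \<Rightarrow> complex) \<Rightarrow> (real \<Rightarrow> complex) set" where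
  "Lq2_space q V \<alpha> \<phi> \<theta> m =
     {f \<in> L2q q.
        sturm_op q V f \<in> L2q q \<and>
        (\<exists>v d. has_initial_values q f v d \<and>
               v * complex_of_real (cos \<alpha>) + d * complex_of_real (sin \<alpha>) = 0) \<and>
        (\<forall>z. z \<notin> \<real> \<longrightarrow>
           (\<lambda>n::nat. q_wronskian q (weyl_psi \<phi> \<theta> m z) f (q powi (- int n))) \<longlonglongrightarrow> 0)}"

definition fourier_coeff ::
    "real \<Rightarrow> (complex \<Rightarrow> real \<Rightarrow> complex) \<Rightarrow> (complex \<Rightarrow> complex) \<Rightarrow> (nat \<Rightarrow> complex) \<Rightarrow>
     (real \<Rightarrow> complex) \<Rightarrow> nat \<Rightarrow> complex" where
  "fourier_coeff q \<phi> m ev f n = jackson_integral q (\<lambda>y. eigenfun \<phi> m ev n y * f y)"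

end

theory Submission
  imports Defs
begin

text \<open>
  Write \<open>x = q\<^sup>n\<close>, so that a function on the powers of \<open>q\<close> becomes a two-sided sequence and the
  equation becomes a three-term recurrence. Multiplied by the Jackson weight \<open>(1 - q) q\<^sup>n\<close> the operator
  is symmetric, and \<open>-R\<^sub>z\<close>, the negative of its resolvent, has the kernel
  \<open>G\<^sub>z(n, k) = \<phi>(q\<^sup>n, z) \<psi>(q\<^sup>k, z)\<close> for \<open>k \<le> n\<close>, that is, with \<open>\<phi>\<close> at the smaller of the two points.
  Parseval's formula for all of \<open>L\<^sup>2\<close> follows from the completeness relation
  \<open>\<Sum>\<^sub>n \<psi>\<^sub>n(x) \<psi>\<^sub>n(y) = \<delta>\<^sub>x\<^sub>y / ((1 - q) x)\<close>, and this relation is the statement that the residues of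
  \<open>G\<^sub>z\<close> add up to its leading coefficient at infinity.

  Three facts about \<open>G\<close> are used. Green's identity, applied to \<open>G\<^sub>z(\<cdot>, k)\<close> and its conjugate, together with
  the sign that the Weyl circles impose on \<open>\<psi>\<close>, gives \<open>\<bar>G\<^sub>z(n, k)\<bar> \<le> C / \<bar>Im z\<bar>\<close> (lemma \<open>green_bound\<close>).
  The equation for \<open>G\<close> gives \<open>z G\<^sub>z(n, k) = \<delta>\<^sub>n\<^sub>k / weight + O(1 / \<bar>Im z\<bar>)\<close>, because the remainder is a
  combination of three values of \<open>G\<^sub>z\<close> (lemmas \<open>green_equation\<close> and \<open>green_rest_bound\<close>).
  Finally \<open>\<phi>\<close> and \<open>\<theta>\<close> are entire in \<open>z\<close>, so the singularities of \<open>G\<close> are poles at the poles of \<open>m\<close>; the bound forces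
  them to be simple, with residue \<open>r\<^sub>n \<phi>(x, \<lambda>\<^sub>n) \<phi>(y, \<lambda>\<^sub>n)\<close> and \<open>r\<^sub>n \<ge> 0\<close>.

  The bound degenerates on the real axis, where large circles must cross the line of poles. The factor
  \<open>1 - z\<^sup>2 / R\<^sup>2\<close> cures this, since it has modulus \<open>2 \<bar>Im z\<bar> / R\<close> on \<open>\<bar>z\<bar> = R\<close>: integrating
  \<open>(1 - z\<^sup>2 / R\<^sup>2) G\<^sub>z\<close> over that circle yields
  \<open>\<Sum> (1 - \<lambda>\<^sub>n\<^sup>2 / R\<^sup>2) r\<^sub>n \<phi>(x, \<lambda>\<^sub>n) \<phi>(y, \<lambda>\<^sub>n) = \<delta>\<^sub>x\<^sub>y / ((1 - q) x) + O(1 / R)\<close>, the sum being over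
  \<open>\<bar>\<lambda>\<^sub>n\<bar> < R\<close> (lemma \<open>residue_riesz_mean\<close>).
  On the diagonal the terms are nonnegative, so the series converges absolutely and the weights can be removed as
  \<open>R\<close> tends to infinity.
\<close>


section \<open>Difference equations on the lattice of powers of q\<close>

lemma tendsto_int_shift:
  fixes g :: "int \<Rightarrow> 'a::topological_space"
  assumes "(\<lambda>k. g (int k)) \<longlonglongrightarrow> L"
  shows "(\<lambda>k. g (n + int k)) \<longlonglongrightarrow> L"
proof (rule LIMSEQ_offset)
  have "(\<lambda>j. g (int (j + nat (n + \<bar>n\<bar>)))) \<longlonglongrightarrow> L"
    using assms by (rule LIMSEQ_ignore_initial_segment)
  moreover have "(\<lambda>j. g (int (j + nat (n + \<bar>n\<bar>)))) = (\<lambda>j. g (n + int (j + nat \<bar>n\<bar>)))"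
    using abs_ge_minus_self[of n] by (intro ext arg_cong[of _ _ g]) linarith
  ultimately show "(\<lambda>k. g (n + int (k + nat \<bar>n\<bar>))) \<longlonglongrightarrow> L" by simp
qed

locale q_lattice =
  fixes q :: real and V :: "int \<Rightarrow> real"
  assumes q_pos: "0 < q" and q_less_1: "q < 1"
begin

text \<open>
  The potential enters as \<open>V n\<close>, its value at \<open>q\<^sup>n\<close>. The equation is solved for the value at the larger
  neighbour \<open>q\<^sup>n\<^sup>-\<^sup>1\<close>; increasing \<open>n\<close> moves towards \<open>0\<close>.
\<close>
definition solves :: "complex \<Rightarrow> (int \<Rightarrow> complex) \<Rightarrow> bool" where
  "solves z u \<longleftrightarrow> (\<forall>n. u (n - 1) =
     (of_real ((1 + q) / q) + of_real (q powi (2 * n)) * (of_real (V n) - z)) * u n - u (n + 1) / of_real q)"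

definition initial_values :: "(int \<Rightarrow> complex) \<Rightarrow> complex \<Rightarrow> complex \<Rightarrow> bool" where
  "initial_values u v d \<longleftrightarrow>
     (\<lambda>n::nat. u (int n)) \<longlonglongrightarrow> v \<and> (\<lambda>n::nat. (u (int n) - v) / of_real (q ^ n)) \<longlonglongrightarrow> d"

definition weight :: "int \<Rightarrow> real" where
  "weight n = (1 - q) * q powi n"

text \<open>
  The sequence form of the \<open>q\<close>-Wronskian with its normalising factor: the term \<open>u n * v n\<close> in the two
  backward differences cancels.
\<close>
definition casoratian :: "(int \<Rightarrow> complex) \<Rightarrow> (int \<Rightarrow> complex) \<Rightarrow> int \<Rightarrow> complex" where
  "casoratian u v n = of_real ((1 - q) * q powi (- n)) * (u n * v (n - 1) - v n * u (n - 1))"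

lemma q_nz [simp]: "q \<noteq> 0" "complex_of_real q \<noteq> 0"
  using q_pos by auto

lemma weight_pos: "0 < weight n"
  using q_pos q_less_1 by (simp add: weight_def)

lemma weight_sums: "(\<lambda>k::nat. weight (n + int k)) sums (q powi n)"
proof -
  have "(\<lambda>k::nat. (1 - q) * q powi n * q ^ k) sums ((1 - q) * q powi n * (1 / (1 - q)))"
    using q_pos q_less_1 by (intro sums_mult geometric_sums) auto
  moreover have "(1 - q) * q powi n * (1 / (1 - q)) = q powi n"
    using q_less_1 by simp
  moreover have "(\<lambda>k::nat. (1 - q) * q powi n * q ^ k) = (\<lambda>k. weight (n + int k))"
    by (auto simp: weight_def power_int_add)
  ultimately show ?thesis by simp
qed

text \<open>
  Green's identity in local form. It is the reason for the weight: after multiplication by \<open>q\<^sup>-\<^sup>n\<close> the two outer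
  terms of the recurrence become a telescoping difference.
\<close>
lemma casoratian_diff:
  assumes "solves z u" "solves z' v"
  shows "casoratian u v n - casoratian u v (n + 1) = (z - z') * (of_real (weight n) * (u n * v n))"
proof -
  define Q where "Q = complex_of_real q"
  define x where "x = Q powi n"
  have x: "x \<noteq> 0" "Q \<noteq> 0" by (auto simp: x_def Q_def)
  have 11: "complex_of_real (q powi (- n)) = 1 / x"
    by (simp add: x_def Q_def power_int_minus inverse_eq_divide)
  have 12: "complex_of_real (q powi n) = x"
    by (simp add: x_def Q_def)
  have "Q powi (n + 1) = x * Q"
    unfolding x_def using x(2) by (subst power_int_add) auto
  then have 13: "complex_of_real (q powi (- (n + 1))) = 1 / (x * Q)"
    unfolding power_int_minus Q_def by (simp add: inverse_eq_divide)
  have "Q powi (n + n) = x * x"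
    unfolding x_def using x(2) by (subst power_int_add) auto
  then have "Q powi (2 * n) = x\<^sup>2"
    by (simp only: mult_2 power2_eq_square)
  then have 14: "complex_of_real (q powi (2 * n)) = x\<^sup>2"
    by (simp add: Q_def)
  note 1 = 11 12 13 14
  have e: "u (n - 1) = (of_real ((1 + q) / q) + x^2 * (of_real (V n) - z)) * u n - u (n + 1) / Q"
     "v (n - 1) = (of_real ((1 + q) / q) + x^2 * (of_real (V n) - z')) * v n - v (n + 1) / Q"
    using assms(1)[unfolded solves_def, rule_format, of n] assms(2)[unfolded solves_def, rule_format, of n]
    unfolding 14 by (simp_all only: Q_def)
  have e': "u n * v (n - 1) - v n * u (n - 1) = x^2 * (z - z') * u n * v n - (u n * v (n+1) - v n * u (n+1)) / Q"
    unfolding e by (simp add: algebra_simps diff_divide_distrib)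
  show ?thesis
    unfolding casoratian_def of_real_mult 1 weight_def e' add_diff_cancel_right'
    using x by (simp add: divide_simps power2_eq_square) (simp add: algebra_simps)
qed

text \<open>
  In terms of the difference quotients \<open>p n = (u n - v) / q\<^sup>n\<close> the casoratian is a polynomial in convergent
  quantities: the products of the limits \<open>v\<close> and \<open>v'\<close>, which would be divided by \<open>q\<^sup>n\<close>, cancel.
\<close>
lemma casoratian_initial:
  assumes "initial_values u v d" "initial_values u' v' d'"
  shows "(\<lambda>n::nat. casoratian u u' (int n)) \<longlonglongrightarrow> of_real ((1 - q)\<^sup>2 / q) * (v * d' - v' * d)"
proof -
  define Q where "Q = complex_of_real q"
  have Q: "Q \<noteq> 0" by (auto simp: Q_def)
  define p where "p n = (u (int n) - v) / Q ^ n" for n :: nat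
  define p' where "p' n = (u' (int n) - v') / Q ^ n" for n :: nat
  have u: "u (int n) = v + Q ^ n * p n" "u' (int n) = v' + Q ^ n * p' n" for n
    using Q by (simp_all add: p_def p'_def)
  have p: "p \<longlonglongrightarrow> d" "p' \<longlonglongrightarrow> d'"
    using assms by (simp_all add: initial_values_def p_def [abs_def] p'_def [abs_def] Q_def)
  have ps: "(\<lambda>n. p (Suc n)) \<longlonglongrightarrow> d" "(\<lambda>n. p' (Suc n)) \<longlonglongrightarrow> d'"
    using p by (simp_all add: LIMSEQ_Suc)
  have norm_Q: "cmod Q < 1" using q_pos q_less_1 by (simp add: Q_def)
  have Q0: "(\<lambda>n. Q ^ n) \<longlonglongrightarrow> 0"
    using q_pos q_less_1 by (intro LIMSEQ_power_zero) (simp add: Q_def)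
  have "casoratian u u' (int (Suc n)) = (1 - Q) *
      (v * p' n / Q + v' * p (Suc n) - v' * p n / Q - v * p' (Suc n) + Q ^ n * (p (Suc n) * p' n - p' (Suc n) * p n))"
    for n
  proof -
    have 1: "complex_of_real (q powi - int (Suc n)) = 1 / (Q * Q ^ n)"
      using power_int_minus[of Q "int (Suc n)"] power_int_of_nat[of Q "Suc n"] 
      by (simp add: Q_def inverse_eq_divide del: of_nat_Suc)
    have 2: "u (int (Suc n) - 1) = v + Q ^ n * p n" "u' (int (Suc n) - 1) = v' + Q ^ n * p' n"
       using u[of n] by simp_all
    have 3: "complex_of_real (1 - q) = 1 - Q" by (simp add: Q_def)
    show ?thesis
      unfolding casoratian_def 2 u(1)[of "Suc n"] u(2)[of "Suc n"] of_real_mult 1 3 power_Suc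
      using Q by (simp add: divide_simps) (simp add: algebra_simps)
  qed
  moreover have "(\<lambda>n. (1 - Q) *
      (v * p' n / Q + v' * p (Suc n) - v' * p n / Q - v * p' (Suc n) + Q ^ n * (p (Suc n) * p' n - p' (Suc n) * p n)))
    \<longlonglongrightarrow> (1 - Q) * (v * d' / Q + v' * d - v' * d / Q - v * d' + 0 * (d * d' - d' * d))"
    using Q norm_Q by (intro tendsto_intros p ps Q0) auto
  moreover have "(1 - Q) * (v * d' / Q + v' * d - v' * d / Q - v * d' + 0 * (d * d' - d' * d))
     = of_real ((1 - q)\<^sup>2 / q) * (v * d' - v' * d)"
    using Q by (simp add: Q_def [symmetric] field_simps power2_eq_square)
  ultimately have "(\<lambda>n. casoratian u u' (int (Suc n))) \<longlonglongrightarrow> of_real ((1 - q)\<^sup>2 / q) * (v * d' - v' * d)"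
    by simp
  then show ?thesis by (rule LIMSEQ_imp_Suc)
qed

text \<open>
  Green's identity on the interval from \<open>0\<close> to \<open>q\<^sup>n\<close>, with the boundary term at \<open>0\<close> evaluated.
\<close>
lemma casoratian_sums:
  assumes "solves z u" "solves z' u'" "initial_values u v d" "initial_values u' v' d'"
  shows "(\<lambda>k::nat. (z - z') * (of_real (weight (n + int k)) * (u (n + int k) * u' (n + int k)))) sums
           (casoratian u u' n - of_real ((1 - q)\<^sup>2 / q) * (v * d' - v' * d))"
proof -
  let ?L = "of_real ((1 - q)\<^sup>2 / q) * (v * d' - v' * d)"
  have lim: "(\<lambda>k. casoratian u u' (n + int k)) \<longlonglongrightarrow> ?L"
    by (rule tendsto_int_shift[OF casoratian_initial[OF assms(3,4)]])
  have "(\<lambda>k. casoratian u u' (n + int k) - casoratian u u' (n + int (Suc k))) sums (casoratian u u' (n + int 0) - ?L)"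
    by (rule telescope_sums'[OF lim])
  moreover have "casoratian u u' (n + int k) - casoratian u u' (n + int (Suc k)) =
     (z - z') * (of_real (weight (n + int k)) * (u (n + int k) * u' (n + int k)))" for k
    using casoratian_diff[OF assms(1,2), of "n + int k"] by (simp add: add_ac)
  ultimately show ?thesis by simp
qed

lemma solves_cnj:
  assumes "solves z u"
  shows "solves (cnj z) (\<lambda>n. cnj (u n))"
  unfolding solves_def
proof
  fix n
  have "cnj (u (n - 1)) = cnj ((of_real ((1 + q) / q) + of_real (q powi (2 * n)) * (of_real (V n) - z)) * u n
          - u (n + 1) / of_real q)"
    using assms unfolding solves_def by auto
  then show "cnj (u (n - 1)) = (of_real ((1 + q) / q) + of_real (q powi (2 * n)) * (of_real (V n) - cnj z)) * cnj (u n)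
          - cnj (u (n + 1)) / of_real q"
    by (simp only: complex_cnj_diff complex_cnj_add complex_cnj_mult complex_cnj_divide complex_cnj_complex_of_real)
qed

lemma initial_values_cnj: "initial_values u v d \<Longrightarrow> initial_values (\<lambda>n. cnj (u n)) (cnj v) (cnj d)"
  unfolding initial_values_def
  by (auto dest: tendsto_cnj)

lemma initial_values_bounded:
  assumes "initial_values u v d"
  shows "\<exists>B>0. \<forall>m\<ge>n. cmod (u m) \<le> B"
proof -
  have "(\<lambda>k. u (n + int k)) \<longlonglongrightarrow> v"
    using assms by (intro tendsto_int_shift) (simp add: initial_values_def)
  then have "Bseq (\<lambda>k. u (n + int k))"
    by (auto intro!: convergent_imp_Bseq convergentI)
  then obtain B where B: "B > 0" "\<And>k. cmod (u (n + int k)) \<le> B" by (auto simp: Bseq_def)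
  show ?thesis
  proof (intro exI[of _ B] conjI allI impI)
    fix m assume "n \<le> m"
    then show "cmod (u m) \<le> B" using B(2)[of "nat (m - n)"] by simp
  qed (use B in auto)
qed

end

section \<open>The fundamental system and its dependence on the spectral parameter\<close>

locale q_sturm = q_lattice +
  fixes \<alpha> :: real and \<phi> \<theta> :: "complex \<Rightarrow> int \<Rightarrow> complex"
  assumes phi_sol: "solves z (\<phi> z)" and theta_sol: "solves z (\<theta> z)"
    and phi_init: "initial_values (\<phi> z) (of_real (sqrt q / (1 - q) * sin \<alpha>)) (of_real (- (sqrt q / (1 - q)) * cos \<alpha>))"
    and theta_init: "initial_values (\<theta> z) (of_real (sqrt q / (1 - q) * cos \<alpha>)) (of_real (sqrt q / (1 - q) * sin \<alpha>))"
begin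

lemma casoratian_const:
  assumes "solves z u" "solves z u'" "initial_values u v d" "initial_values u' v' d'"
  shows "casoratian u u' n = of_real ((1 - q)\<^sup>2 / q) * (v * d' - v' * d)"
proof -
  have "(\<lambda>k::nat. 0) sums (casoratian u u' n - of_real ((1 - q)\<^sup>2 / q) * (v * d' - v' * d))"
    using casoratian_sums[OF assms, of n] by simp
  from sums_unique2[OF this sums_zero] show ?thesis by simp
qed

lemma casoratian_phi_theta: "casoratian (\<phi> z) (\<theta> z) n = 1"
proof -
  have "casoratian (\<phi> z) (\<theta> z) n = of_real ((1 - q)\<^sup>2 / q * ((sqrt q / (1 - q))\<^sup>2 * ((sin \<alpha>)\<^sup>2 + (cos \<alpha>)\<^sup>2)))"
    unfolding casoratian_const[OF phi_sol theta_sol phi_init theta_init] of_real_mult[symmetric] of_real_diff[symmetric]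
    by (intro arg_cong[of _ _ of_real]) (simp only: algebra_simps power2_eq_square minus_mult_left minus_mult_right)
  also have "(1 - q)\<^sup>2 / q * ((sqrt q / (1 - q))\<^sup>2 * ((sin \<alpha>)\<^sup>2 + (cos \<alpha>)\<^sup>2)) = 1"
    using q_pos q_less_1 by (simp only: sin_cos_squared_add) (simp add: power_divide)
  finally show ?thesis by simp
qed

text \<open>
  Cramer's rule for the two consecutive values of \<open>u\<close>, so valid for an arbitrary sequence. If \<open>u\<close> is a
  solution its coefficients are casoratians, which are governed by the data at \<open>0\<close>; this gives uniqueness and
  variation of constants below.
\<close>
lemma phi_theta_expansion:
  "u n = \<phi> z n * casoratian u (\<theta> z) n - \<theta> z n * casoratian u (\<phi> z) n"
proof -
  have "\<phi> z n * casoratian u (\<theta> z) n - \<theta> z n * casoratian u (\<phi> z) n = u n * casoratian (\<phi> z) (\<theta> z) n"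
    by (simp add: casoratian_def algebra_simps)
  then show ?thesis by (simp add: casoratian_phi_theta)
qed

lemma solves_unique:
  assumes "solves z u" "solves z u'" "initial_values u v d" "initial_values u' v d"
  shows "u n = u' n"
  unfolding phi_theta_expansion[of u n z] phi_theta_expansion[of u' n z]
    casoratian_const[OF assms(1) theta_sol assms(3) theta_init] casoratian_const[OF assms(2) theta_sol assms(4) theta_init]
    casoratian_const[OF assms(1) phi_sol assms(3) phi_init] casoratian_const[OF assms(2) phi_sol assms(4) phi_init]
  by simp

text \<open>
  The potential and the initial data are real, so conjugation maps the solution for \<open>z\<close> to a solution for
  \<open>cnj z\<close> with the same initial data.
\<close>
lemma phi_cnj: "\<phi> (cnj z) n = cnj (\<phi> z n)"
proof (rule solves_unique[OF phi_sol _ phi_init])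
  show "solves (cnj z) (\<lambda>n. cnj (\<phi> z n))" by (rule solves_cnj[OF phi_sol])
  show "initial_values (\<lambda>n. cnj (\<phi> z n)) (of_real (sqrt q / (1 - q) * sin \<alpha>)) (of_real (- (sqrt q / (1 - q)) * cos \<alpha>))"
    using initial_values_cnj[OF phi_init[of z]] by simp
qed

lemma theta_cnj: "\<theta> (cnj z) n = cnj (\<theta> z n)"
proof (rule solves_unique[OF theta_sol _ theta_init])
  show "solves (cnj z) (\<lambda>n. cnj (\<theta> z n))" by (rule solves_cnj[OF theta_sol])
  show "initial_values (\<lambda>n. cnj (\<theta> z n)) (of_real (sqrt q / (1 - q) * cos \<alpha>)) (of_real (sqrt q / (1 - q) * sin \<alpha>))"
    using initial_values_cnj[OF theta_init[of z]] by simp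
qed

lemma phi_real:
  assumes "z \<in> \<real>"
  shows "\<phi> z n \<in> \<real>"
  using phi_cnj[of z n] assms by (simp add: Reals_cnj_iff)

lemma phi_nonzero: "\<phi> z n \<noteq> 0 \<or> \<phi> z (n + 1) \<noteq> 0"
  using casoratian_phi_theta[of z "n + 1"] by (auto simp: casoratian_def)

text \<open>
  A Volterra equation comparing the parameters \<open>z\<close> and \<open>z0\<close>: the summation runs over the points
  between \<open>0\<close> and \<open>q\<^sup>n\<close>, and the difference of the parameters appears as a factor.
\<close>
lemma variation_of_constants:
  assumes "\<And>z. solves z (u z)" "\<And>z. initial_values (u z) v d"
  shows "(\<lambda>j::nat. (z - z0) * (of_real (weight (n + int j)) *
            ((\<phi> z0 n * \<theta> z0 (n + int j) - \<theta> z0 n * \<phi> z0 (n + int j)) * u z (n + int j))))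
         sums (u z n - u z0 n)"
proof -
  let ?c = "of_real ((1 - q)\<^sup>2 / q) :: complex"
  define c1 where "c1 = casoratian (u z0) (\<theta> z0) n"
  define c2 where "c2 = casoratian (u z0) (\<phi> z0) n"
  have c:
    "(\<lambda>k::nat. (z - z0) * (of_real (weight (n + int k)) * (u z (n + int k) * \<theta> z0 (n + int k)))) sums (casoratian (u z) (\<theta> z0) n - c1)"
    "(\<lambda>k::nat. (z - z0) * (of_real (weight (n + int k)) * (u z (n + int k) * \<phi> z0 (n + int k)))) sums (casoratian (u z) (\<phi> z0) n - c2)"
    using casoratian_sums[OF assms(1)[of z] theta_sol[of z0] assms(2)[of z] theta_init[of z0], of n]
      casoratian_sums[OF assms(1)[of z] phi_sol[of z0] assms(2)[of z] phi_init[of z0], of n]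
    unfolding c1_def c2_def casoratian_const[OF assms(1)[of z0] theta_sol[of z0] assms(2)[of z0] theta_init[of z0]]
      casoratian_const[OF assms(1)[of z0] phi_sol[of z0] assms(2)[of z0] phi_init[of z0]] by blast+
  have "(\<lambda>k::nat. \<phi> z0 n * ((z - z0) * (of_real (weight (n + int k)) * (u z (n + int k) * \<theta> z0 (n + int k))))
        - \<theta> z0 n * ((z - z0) * (of_real (weight (n + int k)) * (u z (n + int k) * \<phi> z0 (n + int k)))))
       sums (\<phi> z0 n * (casoratian (u z) (\<theta> z0) n - c1) - \<theta> z0 n * (casoratian (u z) (\<phi> z0) n - c2))"
    by (intro sums_diff sums_mult c)
  moreover have "\<phi> z0 n * (casoratian (u z) (\<theta> z0) n - c1) - \<theta> z0 n * (casoratian (u z) (\<phi> z0) n - c2) = u z n - u z0 n"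
    unfolding c1_def c2_def using phi_theta_expansion[of "u z" n z0] phi_theta_expansion[of "u z0" n z0] by algebra
  ultimately have "(\<lambda>k::nat. \<phi> z0 n * ((z - z0) * (of_real (weight (n + int k)) * (u z (n + int k) * \<theta> z0 (n + int k))))
        - \<theta> z0 n * ((z - z0) * (of_real (weight (n + int k)) * (u z (n + int k) * \<phi> z0 (n + int k)))))
       sums (u z n - u z0 n)" by simp
  then show ?thesis by (simp add: algebra_simps)
qed

lemma norm_weighted_sum_le:
  assumes "(\<lambda>j::nat. of_real (weight (n + int j)) * g j) sums s" "\<And>j. cmod (g j) \<le> M"
  shows "cmod s \<le> q powi n * M"
proof -
  have "(\<lambda>j. weight (n + int j) * M) sums (q powi n * M)"
    by (intro sums_mult2 weight_sums)
  then have "summable (\<lambda>j. weight (n + int j) * M)" "suminf (\<lambda>j. weight (n + int j) * M) = q powi n * M"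
    by (auto simp: sums_iff)
  moreover have "cmod (of_real (weight (n + int j)) * g j) \<le> weight (n + int j) * M" for j
    using assms(2)[of j] weight_pos[of "n + int j"] by (simp add: norm_mult mult_left_mono)
  ultimately show ?thesis
    using norm_suminf_le[of "\<lambda>j. of_real (weight (n + int j)) * g j" "\<lambda>j. weight (n + int j) * M"] assms(1)
    by (simp add: sums_iff)
qed

text \<open>
  A solution with fixed data at \<open>0\<close> is entire in the spectral parameter. The Volterra equation first bounds
  \<open>u z\<close> uniformly for \<open>z\<close> near \<open>z0\<close>; inserted once more, it shows that \<open>u z\<close> is within \<open>O(\<bar>z - z0\<bar>)\<close>
  of \<open>u z0\<close>, uniformly in the lattice point, and dividing by \<open>z - z0\<close> identifies the derivative as the
  Volterra sum formed with \<open>u z0\<close>.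
\<close>
lemma solves_holomorphic:
  assumes "\<And>z. solves z (u z)" "\<And>z. initial_values (u z) v d"
  shows "(\<lambda>z. u z n) holomorphic_on UNIV"
proof -
  have "\<exists>D. ((\<lambda>z. u z n) has_field_derivative D) (at z0)" for z0
  proof -
    obtain B1 B2 where B12: "\<forall>m\<ge>n. cmod (\<phi> z0 m) \<le> B1" "\<forall>m\<ge>n. cmod (\<theta> z0 m) \<le> B2" "B1 > 0" "B2 > 0"
      using initial_values_bounded[OF phi_init] initial_values_bounded[OF theta_init] by metis
    define K where "K k j = \<phi> z0 k * \<theta> z0 j - \<theta> z0 k * \<phi> z0 j" for k j
    \<comment> \<open>A bound for the Volterra kernel between \<open>0\<close> and \<open>q\<^sup>n\<close>, uniform in both arguments.\<close>
    define B where "B = B1 * B2 + B2 * B1"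
    have B: "0 < B" using B12 by (auto simp: B_def intro: add_pos_pos)
    have K: "cmod (K k j) \<le> B" if "k \<ge> n" "j \<ge> n" for k j
      unfolding K_def B_def using B12 that
      by (intro order_trans[OF norm_triangle_ineq4] add_mono) (auto simp: norm_mult intro!: mult_mono)
    define c where "c = B * q powi n"
    have c: "0 < c" using B q_pos by (simp add: c_def)
    have var: "(\<lambda>j::nat. of_real (weight (k + int j)) * ((z - z0) * (K k (k + int j) * u z (k + int j))))
         sums (u z k - u z0 k)" for z k
      using variation_of_constants[OF assms, of z z0 k] by (simp add: K_def mult_ac)
    have step: "cmod (u z k - u z0 k) \<le> cmod (z - z0) * (c * M)"
      if M: "\<And>m. m \<ge> n \<Longrightarrow> cmod (u z m) \<le> M" and k: "k \<ge> n" for z M k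
    proof -
      have "0 \<le> M" using M[of n] norm_ge_zero[of "u z n"] by linarith
      have "cmod (u z k - u z0 k) \<le> q powi k * (cmod (z - z0) * (B * M))"
      proof (rule norm_weighted_sum_le[OF var])
        fix j :: nat
        have "cmod (K k (k + int j)) * cmod (u z (k + int j)) \<le> B * M"
          using k B by (intro mult_mono K M) auto
        then show "cmod ((z - z0) * (K k (k + int j) * u z (k + int j))) \<le> cmod (z - z0) * (B * M)"
          by (simp add: norm_mult mult_left_mono)
      qed
      also have "\<dots> \<le> q powi n * (cmod (z - z0) * (B * M))"
        using k q_pos q_less_1 B \<open>0 \<le> M\<close> by (intro mult_right_mono power_int_decreasing) auto
      finally show ?thesis by (simp add: c_def mult_ac)
    qed
    obtain A where A: "\<And>m. m \<ge> n \<Longrightarrow> cmod (u z0 m) \<le> A" "0 < A"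
      using initial_values_bounded[OF assms(2), of n z0] by metis
    have unif: "cmod (u z k) \<le> 2 * A" if z: "cmod (z - z0) * c \<le> 1 / 2" and k: "k \<ge> n" for z k
    proof -
      obtain M where M: "\<And>m. m \<ge> n \<Longrightarrow> cmod (u z m) \<le> M"
        using initial_values_bounded[OF assms(2), of n z] by metis
      \<comment> \<open>The supremum is finite but not yet controlled; the Volterra equation gives \<open>S \<le> A + S / 2\<close>.\<close>
      define S where "S = (SUP m\<in>{n..}. cmod (u z m))"
      have bdd: "bdd_above ((\<lambda>m. cmod (u z m)) ` {n..})" using M by (intro bdd_aboveI2[where M=M]) auto
      have S: "cmod (u z m) \<le> S" if "m \<ge> n" for m
        unfolding S_def using that by (intro cSUP_upper bdd) auto
      have "0 \<le> S" using S[of n] norm_ge_zero[of "u z n"] by linarith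
      have "S \<le> A + S / 2"
        unfolding S_def
      proof (rule cSUP_least)
        fix m assume "m \<in> {n..}"
        then have m: "m \<ge> n" by simp
        have "cmod (u z m) \<le> cmod (u z0 m) + cmod (u z m - u z0 m)"
          using norm_triangle_ineq[of "u z0 m" "u z m - u z0 m"] by simp
        also have "\<dots> \<le> A + cmod (z - z0) * c * S"
          using A(1)[OF m] step[OF S m] by (simp add: mult_ac)
        also have "\<dots> \<le> A + 1 / 2 * S"
          using z \<open>0 \<le> S\<close> by (intro add_left_mono mult_right_mono)
        finally show "cmod (u z m) \<le> A + (SUP m\<in>{n..}. cmod (u z m)) / 2"
          by (simp add: S_def)
      qed auto
      then show ?thesis using S[OF k] by linarith
    qed
    define D where "D = (\<Sum>j. of_real (weight (n + int j)) * (K n (n + int j) * u z0 (n + int j)))"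
    have D: "(\<lambda>j::nat. of_real (weight (n + int j)) * (K n (n + int j) * u z0 (n + int j))) sums D"
      unfolding D_def
    proof (rule summable_sums, rule summable_comparison_test'[where N=0])
      show "summable (\<lambda>j. weight (n + int j) * (B * A))"
        using weight_sums[of n] by (intro summable_mult2) (auto simp: sums_iff)
      fix j :: nat
      have "cmod (K n (n + int j)) * cmod (u z0 (n + int j)) \<le> B * A"
        using B by (intro mult_mono K A) auto
      then show "norm (of_real (weight (n + int j)) * (K n (n + int j) * u z0 (n + int j))) \<le> weight (n + int j) * (B * A)"
        using weight_pos[of "n + int j"] by (simp add: norm_mult mult_left_mono)
    qed
    have quad: "cmod ((u z n - u z0 n) / (z - z0) - D) \<le> c * c * (2 * A) * cmod (z - z0)"
      if z: "cmod (z - z0) * c \<le> 1 / 2" "z \<noteq> z0" for z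
    proof -
      have u2: "\<And>m. m \<ge> n \<Longrightarrow> cmod (u z m) \<le> 2 * A" using unif z by blast
      have "(\<lambda>j::nat. of_real (weight (n + int j)) * ((z - z0) * (K n (n + int j) * u z (n + int j))) / (z - z0)
               - of_real (weight (n + int j)) * (K n (n + int j) * u z0 (n + int j)))
            sums ((u z n - u z0 n) / (z - z0) - D)"
        by (intro sums_diff sums_divide var D)
      moreover have "w * ((z - z0) * X) / (z - z0) = w * X" for w X
        using z by (simp add: mult.left_commute[of w])
      then have "(\<lambda>j::nat. of_real (weight (n + int j)) * ((z - z0) * (K n (n + int j) * u z (n + int j))) / (z - z0)
               - of_real (weight (n + int j)) * (K n (n + int j) * u z0 (n + int j)))
           = (\<lambda>j. of_real (weight (n + int j)) * (K n (n + int j) * (u z (n + int j) - u z0 (n + int j))))"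
        by (simp add: right_diff_distrib)
      ultimately have "(\<lambda>j. of_real (weight (n + int j)) * (K n (n + int j) * (u z (n + int j) - u z0 (n + int j))))
            sums ((u z n - u z0 n) / (z - z0) - D)" by simp
      then have "cmod ((u z n - u z0 n) / (z - z0) - D) \<le> q powi n * (B * (cmod (z - z0) * (c * (2 * A))))"
      proof (rule norm_weighted_sum_le)
        fix j :: nat
        show "cmod (K n (n + int j) * (u z (n + int j) - u z0 (n + int j))) \<le> B * (cmod (z - z0) * (c * (2 * A)))"
          unfolding norm_mult using B by (intro mult_mono K step u2) auto
      qed
      then show ?thesis by (simp add: c_def mult_ac)
    qed
    have "((\<lambda>z. (u z n - u z0 n) / (z - z0) - D) \<longlongrightarrow> 0) (at z0)"
    proof (rule Lim_null_comparison)
      have "eventually (\<lambda>z. z \<noteq> z0) (at z0)" by (simp add: eventually_at_filter)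
      moreover have "eventually (\<lambda>z. cmod (z - z0) * c < 1 / 2) (at z0)"
        by (rule order_tendstoD) (auto intro!: tendsto_eq_intros)
      ultimately show "eventually (\<lambda>z. cmod ((u z n - u z0 n) / (z - z0) - D) \<le> c * c * (2 * A) * cmod (z - z0)) (at z0)"
        by eventually_elim (use quad in auto)
      show "((\<lambda>z. c * c * (2 * A) * cmod (z - z0)) \<longlongrightarrow> 0) (at z0)"
        by (auto intro!: tendsto_eq_intros)
    qed
    then have "((\<lambda>z. u z n) has_field_derivative D) (at z0)"
      by (simp add: has_field_derivative_iff LIM_zero_iff)
    then show ?thesis by blast
  qed
  then show ?thesis
    by (auto simp: holomorphic_on_def field_differentiable_def)
qed

lemma phi_holomorphic: "(\<lambda>z. \<phi> z n) holomorphic_on A"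
  using solves_holomorphic[OF phi_sol phi_init] holomorphic_on_subset by blast

lemma theta_holomorphic: "(\<lambda>z. \<theta> z n) holomorphic_on A"
  using solves_holomorphic[OF theta_sol theta_init] holomorphic_on_subset by blast

end

section \<open>Flux of a solution and real boundary conditions\<close>

context q_lattice
begin

text \<open>
  Up to the factor \<open>2 \<i>\<close> this is the casoratian of \<open>u\<close> and its conjugate. For
  \<open>u = \<theta> z + l * \<phi> z\<close> with \<open>z\<close> not real, the sign of \<open>Im z * flux u n\<close> tells whether \<open>l\<close> lies inside or outside the Weyl circle at \<open>q\<^sup>n\<close>.
\<close>
definition flux :: "(int \<Rightarrow> complex) \<Rightarrow> int \<Rightarrow> real" where
  "flux u n = (1 - q) * q powi (- n) * Im (u n * cnj (u (n - 1)))"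

lemma casoratian_cnj: "casoratian u (\<lambda>n. cnj (u n)) n = of_real (2 * flux u n) * \<i>"
  by (simp add: casoratian_def flux_def complex_eq_iff)

lemma flux_diff:
  assumes "solves z u"
  shows "flux u n - flux u (n + 1) = Im z * (weight n * (cmod (u n))\<^sup>2)"
proof -
  have "of_real (2 * (flux u n - flux u (n + 1))) * \<i> = (z - cnj z) * of_real (weight n * (cmod (u n))\<^sup>2)"
    using casoratian_diff[OF assms solves_cnj[OF assms], of n] unfolding casoratian_cnj complex_norm_square [symmetric] of_real_mult
    by (simp add: algebra_simps)
  also have "z - cnj z = of_real (2 * Im z) * \<i>"
    by (simp add: complex_eq_iff)
  finally have "Im (of_real (2 * (flux u n - flux u (n + 1))) * \<i>) = Im (of_real (2 * Im z) * \<i> * of_real (weight n * (cmod (u n))\<^sup>2))"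
    by simp
  then show ?thesis by simp
qed

lemma flux_antimono:
  assumes "solves z u" "i \<le> n"
  shows "Im z * flux u n \<le> Im z * flux u i"
  using assms(2)
proof (induction n rule: int_ge_induct)
  case (step n)
  have "Im z * flux u (n + 1) = Im z * flux u n - (Im z)\<^sup>2 * (weight n * (cmod (u n))\<^sup>2)"
    using flux_diff[OF assms(1), of n] by (simp add: algebra_simps power2_eq_square)
  moreover have "0 \<le> (Im z)\<^sup>2 * (weight n * (cmod (u n))\<^sup>2)"
    using weight_pos[of n] by simp
  ultimately show ?case using step by linarith
qed simp

lemma flux_tendsto_0:
  assumes "initial_values u (of_real v) (of_real d)"
  shows "(\<lambda>k::nat. flux u (n + int k)) \<longlonglongrightarrow> 0"
proof -
  have "(\<lambda>k. casoratian u (\<lambda>n. cnj (u n)) (int k)) \<longlonglongrightarrow> 0"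
    using casoratian_initial[OF assms initial_values_cnj[OF assms]] by simp
  from tendsto_Im[OF tendsto_int_shift[OF this, of n]] have "(\<lambda>k. 2 * flux u (n + int k)) \<longlonglongrightarrow> 0"
    unfolding casoratian_cnj by simp
  from tendsto_mult_left[OF this, of "1 / 2"] show ?thesis by simp
qed

text \<open>
  The flux through \<open>q\<^sup>k\<close> is \<open>Im z\<close> times the squared norm of \<open>u\<close> between \<open>0\<close> and \<open>q\<^sup>k\<close>,
  since real initial data carry no flux at \<open>0\<close>. One term of that norm suffices here.
\<close>
lemma flux_lower_bound:
  assumes "solves z u" "initial_values u (of_real v) (of_real d)" "k \<le> n"
  shows "(Im z)\<^sup>2 * (weight n * (cmod (u n))\<^sup>2) \<le> Im z * flux u k"
proof -
  have nonneg: "0 \<le> Im z * flux u i" for i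
  proof (rule LIMSEQ_le_const2)
    have "(\<lambda>j. Im z * flux u (i + int j)) \<longlonglongrightarrow> Im z * 0"
      by (intro tendsto_intros flux_tendsto_0[OF assms(2)])
    then show "(\<lambda>j. Im z * flux u (i + int j)) \<longlonglongrightarrow> 0" by simp
    show "\<exists>N. \<forall>j\<ge>N. Im z * flux u (i + int j) \<le> Im z * flux u i"
      using flux_antimono[OF assms(1)] by auto
  qed
  have "(Im z)\<^sup>2 * (weight n * (cmod (u n))\<^sup>2) = Im z * flux u n - Im z * flux u (n + 1)"
    using flux_diff[OF assms(1), of n] by (simp add: algebra_simps power2_eq_square)
  also have "\<dots> \<le> Im z * flux u k"
    using nonneg[of "n + 1"] flux_antimono[OF assms(1,3)] by simp
  finally show ?thesis .
qed

lemma flux_casoratian: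
  "flux u k * (cmod (v k))\<^sup>2 - flux v k * (cmod (u k))\<^sup>2 = - Im (u k * v k * cnj (casoratian u v k))"
proof -
  define c where "c = (1 - q) * q powi (- k)"
  have *: "Im (a * cnj a') * (cmod b)\<^sup>2 - Im (b * cnj b') * (cmod a)\<^sup>2 = - Im (a * b * cnj (a * b' - b * a'))"
    for a a' b b' :: complex
    unfolding cmod_power2 by (simp add: algebra_simps power2_eq_square)
  have "flux u k * (cmod (v k))\<^sup>2 - flux v k * (cmod (u k))\<^sup>2
     = c * (Im (u k * cnj (u (k - 1))) * (cmod (v k))\<^sup>2 - Im (v k * cnj (v (k - 1))) * (cmod (u k))\<^sup>2)"
    by (simp only: flux_def c_def[symmetric] right_diff_distrib mult.assoc)
  also have "\<dots> = c * (- Im (u k * v k * cnj (u k * v (k - 1) - v k * u (k - 1))))"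
    unfolding * ..
  also have "c * (- Im (w * cnj X)) = - Im (w * cnj (of_real c * X))" for w X
    by (simp add: algebra_simps)
  finally show ?thesis by (simp only: casoratian_def c_def[symmetric])
qed

text \<open>
  The real boundary condition with angle \<open>\<beta>\<close> at \<open>q\<^sup>n\<close>; the second summand is
  \<open>q_shift_inv q (q_deriv q u)\<close>, in sequence form, times \<open>sin \<beta>\<close>.
\<close>
definition boundary_form :: "real \<Rightarrow> int \<Rightarrow> (int \<Rightarrow> complex) \<Rightarrow> complex" where
  "boundary_form \<beta> n u = u n * of_real (cos \<beta>) + (u (n - 1) - u n) * of_real (q powi (1 - n) / (1 - q) * sin \<beta>)"

text \<open>
  A real boundary condition makes \<open>u n\<close> and \<open>u (n - 1)\<close> real multiples of a common number.
\<close>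
lemma boundary_form_zero_imp_flux_zero:
  assumes "boundary_form \<beta> n u = 0"
  shows "flux u n = 0"
proof (cases "sin \<beta> = 0")
  case True
  then have "cos \<beta> \<noteq> 0" using sin_cos_squared_add[of \<beta>] by auto
  then have "u n = 0" using assms True by (simp add: boundary_form_def)
  then show ?thesis by (simp add: flux_def)
next
  case False
  define t where "t = q powi (1 - n) / (1 - q) * sin \<beta>"
  have t: "t \<noteq> 0" using False q_pos q_less_1 by (simp add: t_def)
  have "u (n - 1) * of_real t = u n * of_real (t - cos \<beta>)"
    using assms unfolding boundary_form_def t_def[symmetric] of_real_diff by algebra
  then have "u (n - 1) = u n * of_real ((t - cos \<beta>) / t)"
    using t by (simp add: field_simps)
  then have "u n * cnj (u (n - 1)) = of_real ((cmod (u n))\<^sup>2 * ((t - cos \<beta>) / t))"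
    by (simp only: complex_cnj_mult complex_cnj_complex_of_real mult.assoc[symmetric] complex_norm_square of_real_mult)
  then show ?thesis by (simp add: flux_def)
qed

lemma boundary_form_linear: "boundary_form \<beta> n (\<lambda>n. u n + c * v n) = boundary_form \<beta> n u + c * boundary_form \<beta> n v"
  unfolding boundary_form_def by (simp only: algebra_simps)

lemma boundary_form_cnj: "boundary_form \<beta> n (\<lambda>n. cnj (u n)) = cnj (boundary_form \<beta> n u)"
  by (simp add: boundary_form_def)

lemma solves_linear:
  assumes "solves z u" "solves z v"
  shows "solves z (\<lambda>n. u n + c * v n)"
  unfolding solves_def
proof
  fix n
  show "u (n - 1) + c * v (n - 1) = (of_real ((1 + q) / q) + of_real (q powi (2 * n)) * (of_real (V n) - z)) * (u n + c * v n)
     - (u (n + 1) + c * v (n + 1)) / of_real q"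
    unfolding assms(1)[unfolded solves_def, rule_format, of n] assms(2)[unfolded solves_def, rule_format, of n]
    by (simp add: algebra_simps add_divide_distrib)
qed

text \<open>
  The basic energy estimate for a kernel \<open>u n * v k\<close>. The left-hand side is bounded through the flux of \<open>u\<close>
  at \<open>k\<close>; subtracting the flux of \<open>v\<close>, which has the opposite sign, turns this into the imaginary part of the
  diagonal value, by the identity \<open>flux_casoratian\<close>.
\<close>
lemma flux_product_bound:
  assumes "solves z u" "initial_values u (of_real v0) (of_real d0)" "casoratian u v k = 1" "Im z * flux v k \<le> 0" "k \<le> n"
  shows "(Im z)\<^sup>2 * (weight n * (cmod (u n * v k))\<^sup>2) \<le> - (Im z * Im (u k * v k))"
proof -
  have "(Im z)\<^sup>2 * (weight n * (cmod (u n * v k))\<^sup>2) = (Im z)\<^sup>2 * (weight n * (cmod (u n))\<^sup>2) * (cmod (v k))\<^sup>2"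
    by (simp add: norm_mult power_mult_distrib mult_ac)
  also have "\<dots> \<le> Im z * flux u k * (cmod (v k))\<^sup>2"
    by (intro mult_right_mono flux_lower_bound[OF assms(1,2,5)]) simp
  also have "\<dots> \<le> Im z * flux u k * (cmod (v k))\<^sup>2 - Im z * flux v k * (cmod (u k))\<^sup>2"
    using mult_nonpos_nonneg[OF assms(4), of "(cmod (u k))\<^sup>2"] by simp
  also have "\<dots> = Im z * (flux u k * (cmod (v k))\<^sup>2 - flux v k * (cmod (u k))\<^sup>2)"
    by (simp add: algebra_simps)
  also have "\<dots> = - (Im z * Im (u k * v k))"
    unfolding flux_casoratian assms(3) by (simp only: complex_cnj_one mult_1_right mult_minus_right)
  finally show ?thesis .
qed

text \<open>
  On the diagonal the preceding estimate is quadratic in \<open>u k * v k\<close> on the left and linear on the right, hence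
  bounds it by \<open>1 / (weight k * \<bar>Im z\<bar>)\<close>; with this the estimate for arbitrary \<open>n\<close> becomes explicit.
\<close>
lemma solution_product_bound:
  assumes "solves z u" "initial_values u (of_real v0) (of_real d0)" "casoratian u v k = 1" "Im z * flux v k \<le> 0" "k \<le> n" "Im z \<noteq> 0"
  shows "cmod (u n * v k) \<le> 1 / sqrt (weight n * weight k) / \<bar>Im z\<bar>"
proof -
  let ?i = "\<bar>Im z\<bar>" and ?g = "cmod (u k * v k)"
  have i: "?i > 0" using assms by simp
  have le: "- (Im z * Im (u k * v k)) \<le> ?i * ?g"
  proof -
    have "- (Im z * Im (u k * v k)) \<le> \<bar>Im z * Im (u k * v k)\<bar>" by (rule abs_ge_minus_self)
    also have "\<dots> \<le> ?i * ?g"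
      unfolding abs_mult by (intro mult_left_mono abs_Im_le_cmod) simp
    finally show ?thesis .
  qed
  have "?i * (?i * (weight k * ?g) * ?g) \<le> ?i * ?g"
    using flux_product_bound[OF assms(1-4) order_refl] le
    by (simp add: power2_eq_square mult_ac)
  then have "?i * (weight k * ?g) * ?g \<le> 1 * ?g" using i by simp
  then have "?i * (weight k * ?g) \<le> 1" 
    by (cases "?g = 0") (use mult_le_cancel_right_pos[of ?g "?i * (weight k * ?g)" 1] in \<open>simp_all only: zero_less_norm_iff norm_eq_zero, simp_all\<close>)
  then have g: "?i * ?g \<le> 1 / weight k" using weight_pos[of k] by (simp add: field_simps)
  have "(Im z)\<^sup>2 * (weight n * (cmod (u n * v k))\<^sup>2) \<le> 1 / weight k"
    using flux_product_bound[OF assms(1-5)] le g by linarith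
  then have "(?i * cmod (u n * v k))\<^sup>2 \<le> 1 / (weight n * weight k)"
    using weight_pos[of n] weight_pos[of k] by (simp add: field_simps power_mult_distrib)
  then have "?i * cmod (u n * v k) \<le> sqrt (1 / (weight n * weight k))"
    by (rule real_le_rsqrt)
  then have "?i * cmod (u n * v k) \<le> 1 / sqrt (weight n * weight k)" by (simp add: real_sqrt_divide)
  then show ?thesis unfolding pos_le_divide_eq[OF i] by (simp only: mult.commute)
qed

end

section \<open>Residue sums with Riesz weights\<close>

text \<open>
  The weight vanishes on the circle exactly where the circle meets the real axis, and to the same order as \<open>Im z\<close>.
\<close>
lemma riesz_weight_on_circle:
  assumes "cmod z = R" "0 < R"
  shows "cmod (1 - z\<^sup>2 / of_real (R\<^sup>2)) = 2 * \<bar>Im z\<bar> / R"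
proof -
  have "z * cnj z = of_real (R\<^sup>2)" using assms complex_norm_square[of z] by simp
  then have "1 - z\<^sup>2 / of_real (R\<^sup>2) = z * (cnj z - z) / of_real (R\<^sup>2)"
    using assms by (simp add: field_simps power2_eq_square)
  moreover have "cnj z - z = of_real (- 2 * Im z) * \<i>"
    by (simp add: complex_eq_iff)
  ultimately show ?thesis
    using assms by (simp add: norm_mult norm_divide power2_eq_square norm_power)
qed

text \<open>
  The residue theorem for \<open>(1 - z\<^sup>2 / R\<^sup>2) (F z - D / z)\<close> on the circle of radius \<open>R\<close>. The weight
  compensates the factor \<open>1 / \<bar>Im z\<bar>\<close> of the hypothesis, so the integrand is at most \<open>2 C / R\<^sup>2\<close> on
  the whole circle, however close to the circle the nearest poles are.
\<close>
lemma residue_riesz_mean: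
  fixes F :: "complex \<Rightarrow> complex"
  assumes hol: "F holomorphic_on - P" and discrete: "\<And>z. \<not> z islimpt P"
    and simple: "\<And>p. p \<in> P \<Longrightarrow> ((\<lambda>z. F z * (z - p)) \<longlongrightarrow> r p) (at p)"
    and bound: "\<And>z. z \<notin> \<real> \<Longrightarrow> cmod (z * F z - D) \<le> C / \<bar>Im z\<bar>"
    and R: "0 < R" "\<And>p. p \<in> P \<Longrightarrow> cmod p \<noteq> R"
  shows "cmod ((\<Sum>p\<in>P \<inter> ball 0 R. (1 - p\<^sup>2 / of_real (R\<^sup>2)) * r p) - D) \<le> 2 * C / R"
proof -
  let ?w = "\<lambda>z::complex. 1 - z\<^sup>2 / of_real (R\<^sup>2)"
  let ?C = "circlepath 0 R"
  have C0: "0 \<le> C" using order_trans[OF norm_ge_zero bound[of "\<i>"]] by (simp add: complex_is_Real_iff)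
  have sub_closed: "closed Q" if "Q \<subseteq> P" for Q
    using discrete islimpt_subset[OF _ that] unfolding closed_limpt by blast
  have fin: "finite (P \<inter> ball 0 (R + 1))"
  proof (rule finite_subset)
    show "finite (cball 0 (R + 1) \<inter> P)"
      using discrete by (intro finite_not_islimpt_in_compact) auto
  qed auto
  have w_hol: "?w holomorphic_on A" for A by (intro holomorphic_intros) (use R in auto)
  have path: "path_image ?C \<subseteq> ball 0 (R + 1) - P \<inter> ball 0 (R + 1)" "path_image ?C \<subseteq> - P"
    using R by auto
  have hol': "(\<lambda>z. ?w z * F z) holomorphic_on - P"
    by (intro holomorphic_intros hol w_hol) (use R in auto)
  have res: "residue (\<lambda>z. ?w z * F z) p = ?w p * r p" if "p \<in> P" for p
  proof (rule residue_simple'[of "- (P - {p})"])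
    show "open (- (P - {p}))" by (rule open_Compl[OF sub_closed]) auto
    show "p \<in> - (P - {p})" by simp
    show "(\<lambda>z. ?w z * F z) holomorphic_on - (P - {p}) - {p}"
      by (rule holomorphic_on_subset[OF hol']) auto
    have "((\<lambda>z. ?w z * (F z * (z - p))) \<longlongrightarrow> ?w p * r p) (at p)"
      by (intro tendsto_intros simple that) (use R in auto)
    then show "((\<lambda>z. ?w z * F z * (z - p)) \<longlongrightarrow> ?w p * r p) (at p)" by (simp add: mult.assoc)
  qed
  have "contour_integral ?C (\<lambda>z. ?w z * F z)
      = 2 * pi * \<i> * (\<Sum>p\<in>P \<inter> ball 0 (R + 1). winding_number ?C p * residue (\<lambda>z. ?w z * F z) p)"
  proof (rule Residue_theorem[of "ball 0 (R + 1)"])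
    show "(\<lambda>z. ?w z * F z) holomorphic_on ball 0 (R + 1) - P \<inter> ball 0 (R + 1)"
      by (rule holomorphic_on_subset[OF hol']) auto
    show "\<forall>z. z \<notin> ball 0 (R + 1) \<longrightarrow> winding_number ?C z = 0"
      using R by (intro allI impI winding_number_zero_outside[of _ "ball 0 (R + 1)"]) auto
  qed (use fin path in auto)
  also have "(\<Sum>p\<in>P \<inter> ball 0 (R + 1). winding_number ?C p * residue (\<lambda>z. ?w z * F z) p)
      = (\<Sum>p\<in>P \<inter> ball 0 R. ?w p * r p)"
  proof (rule sum.mono_neutral_cong_right[OF fin])
    show "\<forall>p\<in>P \<inter> ball 0 (R + 1) - P \<inter> ball 0 R. winding_number ?C p * residue (\<lambda>z. ?w z * F z) p = 0"
    proof
      fix p assume "p \<in> P \<inter> ball 0 (R + 1) - P \<inter> ball 0 R"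
      then have "p \<notin> cball 0 R" using R(2)[of p] by auto
      then have "winding_number ?C p = 0"
        using R by (intro winding_number_zero_outside[of _ "cball 0 R"]) auto
      then show "winding_number ?C p * residue (\<lambda>z. ?w z * F z) p = 0" by simp
    qed
    show "winding_number ?C p * residue (\<lambda>z. ?w z * F z) p = ?w p * r p" if "p \<in> P \<inter> ball 0 R" for p
      using that res[of p] winding_number_circlepath[of p 0 R] by simp
  qed auto
  finally have eq: "contour_integral ?C (\<lambda>z. ?w z * F z) = 2 * pi * \<i> * (\<Sum>p\<in>P \<inter> ball 0 R. ?w p * r p)" .
  have "(\<lambda>z. ?w z * F z) contour_integrable_on ?C"
    by (intro contour_integrable_continuous_circlepath holomorphic_on_imp_continuous_on
        holomorphic_on_subset[OF hol' path(2)])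
  from has_contour_integral_integral[OF this] have 1: "((\<lambda>z. ?w z * F z) has_contour_integral (2 * pi * \<i> * (\<Sum>p\<in>P \<inter> ball 0 R. ?w p * r p))) ?C"
    unfolding eq .
  have "((\<lambda>z. D * ?w z / (z - 0)) has_contour_integral (2 * of_real pi * \<i> * (D * ?w 0))) ?C"
    by (rule Cauchy_integral_circlepath_simple) (use R in \<open>auto intro!: holomorphic_intros\<close>)
  from has_contour_integral_diff[OF 1 this]
  have "((\<lambda>z. ?w z * F z - D * ?w z / (z - 0)) has_contour_integral
      (2 * pi * \<i> * ((\<Sum>p\<in>P \<inter> ball 0 R. ?w p * r p) - D))) ?C"
    by (simp add: right_diff_distrib)
  then have "cmod (2 * pi * \<i> * ((\<Sum>p\<in>P \<inter> ball 0 R. ?w p * r p) - D)) \<le> 2 * C / R\<^sup>2 * (2 * pi * R)"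
  \<comment> \<open>The bound on \<open>z * F z - D\<close> is available off the real axis only, so the two real points of the circle
    form an exceptional set.\<close>
  proof (rule has_contour_integral_bound_circlepath_strong[where k="{of_real R, - of_real R}"])
    fix z assume z: "cmod (z - 0) = R" "z \<notin> {of_real R, - of_real R}"
    have zR: "z \<notin> \<real>"
    proof
      assume "z \<in> \<real>"
      then obtain x where "z = of_real x" by (auto elim: Reals_cases)
      then show False using z by (auto simp: abs_if split: if_splits)
    qed
    then have Im: "Im z \<noteq> 0" by (simp add: complex_is_Real_iff)
    have "z \<noteq> 0" using z R by auto
    then have "?w z * F z - D * ?w z / (z - 0) = ?w z * (z * F z - D) / z"
      by (simp add: divide_simps) (simp add: algebra_simps)
    then have "cmod (?w z * F z - D * ?w z / (z - 0)) = 2 * \<bar>Im z\<bar> / R * cmod (z * F z - D) / R"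
      using riesz_weight_on_circle[of z R] z R by (simp add: norm_mult norm_divide)
    also have "\<dots> \<le> 2 * \<bar>Im z\<bar> / R * (C / \<bar>Im z\<bar>) / R"
      using R by (intro divide_right_mono mult_left_mono bound zR) auto
    also have "\<dots> = 2 * C / R\<^sup>2" using Im by (simp add: power2_eq_square)
    finally show "cmod (?w z * F z - D * ?w z / (z - 0)) \<le> 2 * C / R\<^sup>2" .
  qed (use R C0 in auto)
  also have "2 * C / R\<^sup>2 * (2 * pi * R) = (2 * pi) * (2 * C / R)"
    using R by (simp add: power2_eq_square)
  finally have "(2 * pi) * cmod ((\<Sum>p\<in>P \<inter> ball 0 R. ?w p * r p) - D) \<le> (2 * pi) * (2 * C / R)"
    by (simp add: norm_mult)
  then show ?thesis
    by (rule mult_left_le_imp_le) (use pi_gt_zero in simp)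
qed

lemma exists_riesz_radii:
  fixes t :: "nat \<Rightarrow> real"
  obtains R :: "nat \<Rightarrow> real" where "\<And>j. 0 < R j" "\<And>j. R j \<notin> range t" "filterlim R at_top sequentially"
proof -
  have "\<exists>x. real j < x \<and> x \<notin> range t" for j
  proof (rule ccontr)
    assume "\<not> ?thesis"
    then have "{real j<..<real j + 1} \<subseteq> range t" by force
    then have "countable {real j<..<real j + 1}" by (rule countable_subset) simp
    then show False using uncountable_open_interval[of "real j" "real j + 1"] by simp
  qed
  then obtain R where R: "\<And>j. real j < R j" "\<And>j. R j \<notin> range t" by metis
  show thesis
  proof
    show "0 < R j" for j using R(1)[of j] by (meson le_less_trans of_nat_0_le_iff)
    show "filterlim R at_top sequentially"
      by (rule filterlim_at_top_mono[OF filterlim_real_sequentially]) (use R in \<open>auto intro!: always_eventually less_imp_le\<close>)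
  qed (use R in auto)
qed

text \<open>
  For nonnegative terms a partial sum is dominated by the weighted sums in the limit of large radii, hence by \<open>D\<close>.
\<close>
lemma riesz_means_summable:
  fixes x :: "nat \<Rightarrow> real"
  assumes fin: "\<And>R. finite {n. t n < R}" and t: "\<And>n. 0 \<le> t n" and x: "\<And>n. 0 \<le> x n"
    and mean: "\<And>R. 0 < R \<Longrightarrow> R \<notin> range t \<Longrightarrow>
          \<bar>(\<Sum>n | t n < R. (1 - (t n)\<^sup>2 / R\<^sup>2) * x n) - D\<bar> \<le> K / R"
  shows "summable x"
proof -
  obtain R where R: "\<And>j. 0 < R j" "\<And>j. R j \<notin> range t" "filterlim R at_top sequentially"
    using exists_riesz_radii by blast
  have "(\<Sum>n<N. x n) \<le> D" for N
  proof (rule LIMSEQ_le)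
    have "(\<lambda>j. (t n)\<^sup>2 / (R j)\<^sup>2) \<longlonglongrightarrow> 0" for n
      by (intro real_tendsto_divide_at_top[OF tendsto_const] filterlim_pow_at_top R(3)) simp
    then have "(\<lambda>j. \<Sum>n<N. (1 - (t n)\<^sup>2 / (R j)\<^sup>2) * x n) \<longlonglongrightarrow> (\<Sum>n<N. (1 - 0) * x n)"
      by (intro tendsto_intros)
    then show "(\<lambda>j. \<Sum>n<N. (1 - (t n)\<^sup>2 / (R j)\<^sup>2) * x n) \<longlonglongrightarrow> (\<Sum>n<N. x n)" by simp
    have "(\<lambda>j. K / R j) \<longlonglongrightarrow> 0"
      by (intro real_tendsto_divide_at_top[OF tendsto_const] R(3))
    from tendsto_add[OF tendsto_const[of D] this] show "(\<lambda>j. D + K / R j) \<longlonglongrightarrow> D" by simp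
    have "eventually (\<lambda>j. \<forall>n\<in>{..<N}. t n < R j) sequentially"
      using R(3) by (intro eventually_ball_finite) (auto simp: filterlim_at_top_dense)
    then have "eventually (\<lambda>j. (\<Sum>n<N. (1 - (t n)\<^sup>2 / (R j)\<^sup>2) * x n) \<le> D + K / R j) sequentially"
    proof eventually_elim
      case (elim j)
      have "(\<Sum>n<N. (1 - (t n)\<^sup>2 / (R j)\<^sup>2) * x n) \<le> (\<Sum>n | t n < R j. (1 - (t n)\<^sup>2 / (R j)\<^sup>2) * x n)"
      proof (rule sum_mono2[OF fin])
        fix n assume "n \<in> {n. t n < R j} - {..<N}"
        then have "(t n)\<^sup>2 \<le> (R j)\<^sup>2" using t[of n] by (intro power_mono) auto
        then have "(t n)\<^sup>2 / (R j)\<^sup>2 \<le> 1" using R(1)[of j] by (simp add: divide_le_eq_1)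
        then show "0 \<le> (1 - (t n)\<^sup>2 / (R j)\<^sup>2) * x n" using x[of n] by simp
      qed (use elim in auto)
      also have "\<dots> \<le> D + K / R j" using mean[OF R(1,2), of j] by linarith
      finally show ?case .
    qed
    then show "\<exists>J. \<forall>j\<ge>J. (\<Sum>n<N. (1 - (t n)\<^sup>2 / (R j)\<^sup>2) * x n) \<le> D + K / R j"
      by (simp add: eventually_sequentially)
  qed
  from this[of "Suc _"] show ?thesis
    unfolding lessThan_Suc_atMost using x by (intro bounded_imp_summable[where B=D])
qed

text \<open>
  Under absolute convergence the weights, which lie in the unit interval and tend to \<open>1\<close>, may be removed by dominated
  convergence.
\<close>
lemma riesz_means_sums:
  fixes x :: "nat \<Rightarrow> real"
  assumes fin: "\<And>R. finite {n. t n < R}" and t: "\<And>n. 0 \<le> t n" and x: "summable (\<lambda>n. \<bar>x n\<bar>)"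
    and mean: "\<And>R. 0 < R \<Longrightarrow> R \<notin> range t \<Longrightarrow>
          \<bar>(\<Sum>n | t n < R. (1 - (t n)\<^sup>2 / R\<^sup>2) * x n) - D\<bar> \<le> K / R"
  shows "x sums D"
proof -
  obtain R where R: "\<And>j. 0 < R j" "\<And>j. R j \<notin> range t" "filterlim R at_top sequentially"
    using exists_riesz_radii by blast
  define a where "a n j = (if t n < R j then (1 - (t n)\<^sup>2 / (R j)\<^sup>2) * x n else 0)" for n j
  have "((\<lambda>j. suminf (\<lambda>n. a n j)) \<longlongrightarrow> suminf x) sequentially"
  proof (rule conjunct2[OF conjunct2[OF tannerys_theorem[where M="\<lambda>n. \<bar>x n\<bar>"]]])
    fix n
    have "(\<lambda>j. (t n)\<^sup>2 / (R j)\<^sup>2) \<longlonglongrightarrow> 0"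
      by (intro real_tendsto_divide_at_top[OF tendsto_const] filterlim_pow_at_top R(3)) simp
    then have "(\<lambda>j. (1 - (t n)\<^sup>2 / (R j)\<^sup>2) * x n) \<longlonglongrightarrow> (1 - 0) * x n"
      by (intro tendsto_intros)
    moreover have "eventually (\<lambda>j. (1 - (t n)\<^sup>2 / (R j)\<^sup>2) * x n = a n j) sequentially"
    proof -
      have "eventually (\<lambda>j. t n < R j) sequentially"
        using R(3) by (auto simp: filterlim_at_top_dense)
      then show ?thesis by eventually_elim (simp add: a_def)
    qed
    ultimately show "(\<lambda>j. a n j) \<longlonglongrightarrow> x n" by (simp add: tendsto_cong)
  next
    have "norm (a n j) \<le> \<bar>x n\<bar>" for n j
    proof (cases "t n < R j")
      case True
      then have "(t n)\<^sup>2 \<le> (R j)\<^sup>2" using t[of n] by (intro power_mono) auto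
      then have "0 \<le> (t n)\<^sup>2 / (R j)\<^sup>2" "(t n)\<^sup>2 / (R j)\<^sup>2 \<le> 1" using R(1)[of j] by (auto simp: divide_le_eq_1)
      then show ?thesis using True by (simp add: a_def abs_mult mult_left_le_one_le)
    qed (simp add: a_def)
    then show "eventually (\<lambda>(n, j). norm (a n j) \<le> \<bar>x n\<bar>) (at_top \<times>\<^sub>F sequentially)"
      by (intro always_eventually) auto
  qed (use x in auto)
  moreover have "(\<lambda>j. suminf (\<lambda>n. a n j)) \<longlonglongrightarrow> D"
  proof -
    have "suminf (\<lambda>n. a n j) = (\<Sum>n | t n < R j. (1 - (t n)\<^sup>2 / (R j)\<^sup>2) * x n)" for j
      using fin[of "R j"] by (subst suminf_finite[of "{n. t n < R j}"]) (auto simp: a_def)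
    then have le: "norm (suminf (\<lambda>n. a n j) - D) \<le> K / R j" for j
      using mean[OF R(1,2), of j] by simp
    have lim: "(\<lambda>j. K / R j) \<longlonglongrightarrow> 0"
      by (intro real_tendsto_divide_at_top[OF tendsto_const] R(3))
    have "(\<lambda>j. suminf (\<lambda>n. a n j) - D) \<longlonglongrightarrow> 0"
      by (rule Lim_null_comparison[OF always_eventually lim]) (use le in blast)
    then show ?thesis by (simp add: LIM_zero_iff)
  qed
  ultimately have "suminf x = D" by (rule LIMSEQ_unique)
  moreover have "summable x" using x by (rule summable_rabs_cancel)
  ultimately show ?thesis by (simp add: sums_iff)
qed

section \<open>From a resolution of the identity to Parseval's formula\<close>

text \<open>
  The hypothesis is orthonormality of the columns of the matrix \<open>e\<close>, equivalently the completeness relation for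
  its rows. It alone makes the analysis map isometric on square-summable sequences, by polynomial identities on
  finitely supported ones and density.
\<close>
locale dual_orthonormal =
  fixes e :: "nat \<Rightarrow> 'a \<Rightarrow> real"
  assumes dual: "\<And>i k. (\<lambda>n. e n i * e n k) sums (if i = k then 1 else 0)"
begin

lemma parseval_finite:
  assumes "finite A"
  shows "(\<lambda>n. (\<Sum>k\<in>A. e n k * u k)\<^sup>2) sums (\<Sum>k\<in>A. (u k)\<^sup>2)"
proof -
  have "(\<lambda>n. \<Sum>i\<in>A. \<Sum>k\<in>A. u i * u k * (e n i * e n k)) sums (\<Sum>i\<in>A. \<Sum>k\<in>A. u i * u k * (if i = k then 1 else 0))"
    by (intro sums_sum sums_mult dual)
  moreover have "(\<Sum>i\<in>A. \<Sum>k\<in>A. u i * u k * (if i = k then 1 else 0)) = (\<Sum>k\<in>A. (u k)\<^sup>2)"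
    using assms by (simp add: if_distrib [of "\<lambda>x. _ * x"] power2_eq_square cong: if_cong)
  moreover have "(\<Sum>i\<in>A. \<Sum>k\<in>A. u i * u k * (e n i * e n k)) = (\<Sum>k\<in>A. e n k * u k)\<^sup>2" for n
    by (simp add: power2_eq_square sum_product mult_ac)
  ultimately show ?thesis by simp
qed

text \<open>
  Testing the finite Parseval formula on the truncation of \<open>e n\<close> itself: with \<open>S\<close> its squared norm, the term of
  index \<open>n\<close> alone contributes \<open>S\<^sup>2\<close> to a total of \<open>S\<close>.
\<close>
lemma eigenvector_norm_le_1:
  assumes "finite A"
  shows "(\<Sum>k\<in>A. (e n k)\<^sup>2) \<le> 1"
proof -
  let ?S = "\<Sum>k\<in>A. (e n k)\<^sup>2"
  have s: "(\<lambda>j. (\<Sum>k\<in>A. e j k * e n k)\<^sup>2) sums ?S"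
    by (rule parseval_finite[OF assms])
  have "?S\<^sup>2 = (\<Sum>j\<in>{n}. (\<Sum>k\<in>A. e j k * e n k)\<^sup>2)"
    by (simp add: power2_eq_square)
  also have "\<dots> \<le> (\<Sum>j. (\<Sum>k\<in>A. e j k * e n k)\<^sup>2)"
    using s by (intro sum_le_suminf) (auto simp: sums_iff)
  also have "\<dots> = ?S" using s by (simp add: sums_iff)
  finally have "?S * ?S \<le> 1 * ?S" by (simp add: power2_eq_square)
  moreover have "0 \<le> ?S" by (intro sum_nonneg) auto
  ultimately show ?thesis by (cases "?S = 0") (auto simp: mult_le_cancel_right)
qed

lemma eigenvector_square_summable: "(\<lambda>k. (e n k)\<^sup>2) summable_on UNIV"
  by (rule nonneg_bounded_partial_sums_imp_summable_on[where C=1])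
     (auto intro!: eventually_finite_subsets_at_top_weakI eigenvector_norm_le_1)

lemma l2_mult_summable:
  fixes u v :: "'a \<Rightarrow> real"
  assumes "(\<lambda>k. (u k)\<^sup>2) summable_on UNIV" "(\<lambda>k. (v k)\<^sup>2) summable_on UNIV"
  shows "(\<lambda>k. u k * v k) summable_on UNIV"
proof -
  have "(\<lambda>k. (u k)\<^sup>2 + (v k)\<^sup>2) summable_on UNIV" by (intro summable_on_add assms)
  then have "(\<lambda>k. norm (u k * v k)) summable_on UNIV"
  proof (rule summable_on_comparison_test)
    fix k
    have "2 * (\<bar>u k\<bar> * \<bar>v k\<bar>) \<le> (u k)\<^sup>2 + (v k)\<^sup>2"
      using sum_squares_bound[of "\<bar>u k\<bar>" "\<bar>v k\<bar>"] by simp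
    moreover have "0 \<le> \<bar>u k\<bar> * \<bar>v k\<bar>" by simp
    ultimately have "\<bar>u k\<bar> * \<bar>v k\<bar> \<le> (u k)\<^sup>2 + (v k)\<^sup>2" by linarith
    then show "norm (u k * v k) \<le> (u k)\<^sup>2 + (v k)\<^sup>2" by (simp add: abs_mult)
  qed auto
  then show ?thesis by (rule abs_summable_summable)
qed

definition fourier :: "('a \<Rightarrow> real) \<Rightarrow> nat \<Rightarrow> real" where
  "fourier u n = (\<Sum>\<^sub>\<infinity>k. e n k * u k)"

text \<open>
  Bessel's inequality for the part of \<open>u\<close> outside \<open>A\<close>, obtained from the finite case by letting the support grow
  while only finitely many coefficients are kept.
\<close>
lemma tail_bound:
  assumes u: "(\<lambda>k. (u k)\<^sup>2) summable_on UNIV" and A: "finite A"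
  shows "(\<Sum>n<N. (fourier u n - (\<Sum>k\<in>A. e n k * u k))\<^sup>2) \<le> (\<Sum>\<^sub>\<infinity>k. (u k)\<^sup>2) - (\<Sum>k\<in>A. (u k)\<^sup>2)"
proof (rule tendsto_upperbound)
  have "((\<lambda>F. \<Sum>k\<in>F. e n k * u k) \<longlongrightarrow> fourier u n) (finite_subsets_at_top UNIV)" for n
    unfolding fourier_def by (intro infsum_tendsto l2_mult_summable eigenvector_square_summable u)
  then show "((\<lambda>F. \<Sum>n<N. ((\<Sum>k\<in>F. e n k * u k) - (\<Sum>k\<in>A. e n k * u k))\<^sup>2) \<longlongrightarrow>
       (\<Sum>n<N. (fourier u n - (\<Sum>k\<in>A. e n k * u k))\<^sup>2)) (finite_subsets_at_top UNIV)"
    by (intro tendsto_intros)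
  have "(\<Sum>n<N. ((\<Sum>k\<in>F. e n k * u k) - (\<Sum>k\<in>A. e n k * u k))\<^sup>2) \<le> (\<Sum>\<^sub>\<infinity>k. (u k)\<^sup>2) - (\<Sum>k\<in>A. (u k)\<^sup>2)"
    if F: "finite F" "A \<subseteq> F" for F
  proof -
    have "(\<Sum>n<N. ((\<Sum>k\<in>F. e n k * u k) - (\<Sum>k\<in>A. e n k * u k))\<^sup>2) = (\<Sum>n<N. (\<Sum>k\<in>F - A. e n k * u k)\<^sup>2)"
      using F by (simp add: sum_diff)
    also have "\<dots> \<le> (\<Sum>n. (\<Sum>k\<in>F - A. e n k * u k)\<^sup>2)"
      using parseval_finite[of "F - A" u] F by (intro sum_le_suminf) (auto simp: sums_iff)
    also have "\<dots> = (\<Sum>k\<in>F - A. (u k)\<^sup>2)"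
      using parseval_finite[of "F - A" u] F by (simp add: sums_iff)
    also have "\<dots> = (\<Sum>k\<in>F. (u k)\<^sup>2) - (\<Sum>k\<in>A. (u k)\<^sup>2)"
      using F by (simp add: sum_diff)
    also have "\<dots> \<le> (\<Sum>\<^sub>\<infinity>k. (u k)\<^sup>2) - (\<Sum>k\<in>A. (u k)\<^sup>2)"
      using finite_sum_le_infsum[OF u F(1)] by simp
    finally show ?thesis .
  qed
  then show "eventually (\<lambda>F. (\<Sum>n<N. ((\<Sum>k\<in>F. e n k * u k) - (\<Sum>k\<in>A. e n k * u k))\<^sup>2)
       \<le> (\<Sum>\<^sub>\<infinity>k. (u k)\<^sup>2) - (\<Sum>k\<in>A. (u k)\<^sup>2)) (finite_subsets_at_top UNIV)"
    unfolding eventually_finite_subsets_at_top using A by blast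
qed simp

text \<open>
  Bessel's inequality gives one direction. For the other one, the triangle inequality in \<open>\<ell>\<^sup>2\<close> compares the
  coefficients of \<open>u\<close> with those of its restriction to a finite set \<open>A\<close>, for which equality is known; the error
  is the tail outside \<open>A\<close>.
\<close>
lemma parseval_square:
  assumes u: "(\<lambda>k. (u k)\<^sup>2) summable_on UNIV"
  shows "(\<lambda>n. (fourier u n)\<^sup>2) sums (\<Sum>\<^sub>\<infinity>k. (u k)\<^sup>2)"
proof -
  let ?S = "\<Sum>\<^sub>\<infinity>k. (u k)\<^sup>2"
  have bessel: "(\<Sum>n<N. (fourier u n)\<^sup>2) \<le> ?S" for N
    using tail_bound[OF u, of "{}"] by simp
  from this[of "Suc _"] have sm: "summable (\<lambda>n. (fourier u n)\<^sup>2)"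
    unfolding lessThan_Suc_atMost by (intro bounded_imp_summable[where B="?S"]) auto
  define T where "T = (\<Sum>n. (fourier u n)\<^sup>2)"
  have "T \<le> ?S"
    unfolding T_def by (rule suminf_le_const[OF sm bessel])
  have low: "sqrt (\<Sum>k\<in>A. (u k)\<^sup>2) \<le> sqrt T + sqrt (?S - (\<Sum>k\<in>A. (u k)\<^sup>2))" if A: "finite A" for A
  proof -
    let ?cA = "\<lambda>n. \<Sum>k\<in>A. e n k * u k"
    have "sqrt (\<Sum>n<N. (?cA n)\<^sup>2) \<le> sqrt T + sqrt (?S - (\<Sum>k\<in>A. (u k)\<^sup>2))" for N
    proof -
      have "sqrt (\<Sum>n<N. (?cA n)\<^sup>2) = L2_set (\<lambda>n. fourier u n + (?cA n - fourier u n)) {..<N}"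
        by (simp add: L2_set_def)
      also have "\<dots> \<le> L2_set (fourier u) {..<N} + L2_set (\<lambda>n. ?cA n - fourier u n) {..<N}"
        by (rule L2_set_triangle_ineq)
      also have "L2_set (fourier u) {..<N} \<le> sqrt T"
        unfolding L2_set_def T_def by (intro real_sqrt_le_mono sum_le_suminf sm) auto
      also have "L2_set (\<lambda>n. ?cA n - fourier u n) {..<N} = sqrt (\<Sum>n<N. (fourier u n - ?cA n)\<^sup>2)"
        by (simp add: L2_set_def power2_commute)
      also have "\<dots> \<le> sqrt (?S - (\<Sum>k\<in>A. (u k)\<^sup>2))"
        by (intro real_sqrt_le_mono tail_bound u A)
      finally show ?thesis by simp
    qed
    moreover have "(\<lambda>N. sqrt (\<Sum>n<N. (?cA n)\<^sup>2)) \<longlonglongrightarrow> sqrt (\<Sum>k\<in>A. (u k)\<^sup>2)"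
      using parseval_finite[OF A, of u] by (intro tendsto_real_sqrt) (simp add: sums_def)
    ultimately show ?thesis by (intro LIMSEQ_le_const2) auto
  qed
  have lim: "((\<lambda>A. \<Sum>k\<in>A. (u k)\<^sup>2) \<longlongrightarrow> ?S) (finite_subsets_at_top UNIV)"
    by (rule infsum_tendsto[OF u])
  have "sqrt ?S \<le> sqrt T + sqrt (?S - ?S)"
  proof (rule tendsto_le)
    show "((\<lambda>A. sqrt T + sqrt (?S - (\<Sum>k\<in>A. (u k)\<^sup>2))) \<longlongrightarrow> sqrt T + sqrt (?S - ?S)) (finite_subsets_at_top UNIV)"
      by (intro tendsto_intros lim)
    show "((\<lambda>A. sqrt (\<Sum>k\<in>A. (u k)\<^sup>2)) \<longlongrightarrow> sqrt ?S) (finite_subsets_at_top UNIV)"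
      by (intro tendsto_intros lim)
    show "eventually (\<lambda>A. sqrt (\<Sum>k\<in>A. (u k)\<^sup>2) \<le> sqrt T + sqrt (?S - (\<Sum>k\<in>A. (u k)\<^sup>2))) (finite_subsets_at_top UNIV)"
      using low by (intro eventually_finite_subsets_at_top_weakI) auto
  qed simp
  then have "?S \<le> T" by simp
  with \<open>T \<le> ?S\<close> sm show ?thesis by (simp add: sums_iff T_def)
qed

lemma fourier_add:
  assumes "(\<lambda>k. (u k)\<^sup>2) summable_on UNIV" "(\<lambda>k. (v k)\<^sup>2) summable_on UNIV"
  shows "fourier (\<lambda>k. u k + v k) n = fourier u n + fourier v n"
  unfolding fourier_def by (simp add: distrib_left infsum_add l2_mult_summable eigenvector_square_summable assms)

lemma parseval_bilinear:
  assumes u: "(\<lambda>k. (u k)\<^sup>2) summable_on UNIV" and v: "(\<lambda>k. (v k)\<^sup>2) summable_on UNIV"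
  shows "(\<lambda>n. fourier u n * fourier v n) sums (\<Sum>\<^sub>\<infinity>k. u k * v k)"
proof -
  note uv = l2_mult_summable[OF u v]
  have e: "(\<lambda>k. (u k + v k)\<^sup>2) = (\<lambda>k. ((u k)\<^sup>2 + (v k)\<^sup>2) + 2 * (u k * v k))"
    by (auto simp: power2_sum)
  have w: "(\<lambda>k. (u k + v k)\<^sup>2) summable_on UNIV"
    unfolding e by (intro summable_on_add summable_on_cmult_right u v uv)
  have "(\<lambda>n. ((fourier (\<lambda>k. u k + v k) n)\<^sup>2 - (fourier u n)\<^sup>2 - (fourier v n)\<^sup>2) / 2) sums
     (((\<Sum>\<^sub>\<infinity>k. (u k + v k)\<^sup>2) - (\<Sum>\<^sub>\<infinity>k. (u k)\<^sup>2) - (\<Sum>\<^sub>\<infinity>k. (v k)\<^sup>2)) / 2)"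
    by (intro sums_divide sums_diff parseval_square u v w)
  moreover have "(\<Sum>\<^sub>\<infinity>k. (u k + v k)\<^sup>2) = (\<Sum>\<^sub>\<infinity>k. (u k)\<^sup>2) + (\<Sum>\<^sub>\<infinity>k. (v k)\<^sup>2) + 2 * (\<Sum>\<^sub>\<infinity>k. u k * v k)"
    unfolding e by (simp add: infsum_add infsum_cmult_right summable_on_add summable_on_cmult_right u v uv)
  ultimately show ?thesis by (simp add: fourier_add[OF u v] power2_sum)
qed

text \<open>
  The formula is bilinear and contains no conjugation, so the complex case needs the mixed products of real and imaginary part
  as well; these come from polarisation.
\<close>
lemma parseval_complex:
  fixes g :: "'a \<Rightarrow> complex"
  assumes "(\<lambda>k. (cmod (g k))\<^sup>2) summable_on UNIV"
  shows "(\<lambda>n. (\<Sum>\<^sub>\<infinity>k. of_real (e n k) * g k)\<^sup>2) sums (\<Sum>\<^sub>\<infinity>k. (g k)\<^sup>2)"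
proof -
  define u v where "u k = Re (g k)" and "v k = Im (g k)" for k
  have g: "g k = of_real (u k) + \<i> * of_real (v k)" for k
    by (simp add: u_def v_def complex_eq_iff)
  have u: "(\<lambda>k. (u k)\<^sup>2) summable_on UNIV" and v: "(\<lambda>k. (v k)\<^sup>2) summable_on UNIV"
    by (rule summable_on_comparison_test[OF assms]; simp add: u_def v_def cmod_power2)+
  have c: "(\<Sum>\<^sub>\<infinity>k. of_real (e n k) * g k) = of_real (fourier u n) + \<i> * of_real (fourier v n)" for n
  proof (rule infsumI)
    have "((\<lambda>k. e n k * u k) has_sum fourier u n) UNIV" "((\<lambda>k. e n k * v k) has_sum fourier v n) UNIV"
      unfolding fourier_def by (intro has_sum_infsum l2_mult_summable eigenvector_square_summable u v)+
    then have "((\<lambda>k. of_real (e n k * u k) + \<i> * of_real (e n k * v k)) has_sum of_real (fourier u n) + \<i> * of_real (fourier v n)) UNIV"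
      by (intro has_sum_add has_sum_cmult_right has_sum_of_real)
    then show "((\<lambda>k. of_real (e n k) * g k) has_sum of_real (fourier u n) + \<i> * of_real (fourier v n)) UNIV"
      by (simp add: g algebra_simps)
  qed
  have sq: "(of_real a + \<i> * of_real b)\<^sup>2 = of_real (a * a) + (- 1) * of_real (b * b) + 2 * \<i> * of_real (a * b)" for a b
    by (simp add: power2_eq_square algebra_simps)
  have i: "(\<Sum>\<^sub>\<infinity>k. (g k)\<^sup>2) = of_real (\<Sum>\<^sub>\<infinity>k. u k * u k) + (- 1) * of_real (\<Sum>\<^sub>\<infinity>k. v k * v k) + 2 * \<i> * of_real (\<Sum>\<^sub>\<infinity>k. u k * v k)"
    unfolding g sq
    by (intro infsumI has_sum_add has_sum_cmult_right has_sum_of_real has_sum_infsum l2_mult_summable u v)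
  show ?thesis
    unfolding c sq i by (intro sums_add sums_mult sums_of_real parseval_bilinear u v)
qed

end

section \<open>The Green function\<close>

text \<open>
  The number \<open>m z\<close> is a limit of points of the Weyl circles at \<open>q powi N j\<close> with angles that do not depend
  on \<open>z\<close>. The limit-point case fits this form too, because all points of the circles then converge to \<open>m z\<close>.
\<close>
locale q_weyl = q_sturm +
  fixes m :: "complex \<Rightarrow> complex" and N :: "nat \<Rightarrow> int" and \<beta> :: "nat \<Rightarrow> real"
  assumes N: "filterlim N at_bot sequentially"
    and m_lim: "z \<notin> \<real> \<Longrightarrow> (\<lambda>j. - (boundary_form (\<beta> j) (N j) (\<theta> z) / boundary_form (\<beta> j) (N j) (\<phi> z))) \<longlonglongrightarrow> m z"
    and m_meromorphic: "m meromorphic_on UNIV"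
    and m_analytic: "\<not> is_pole m z \<Longrightarrow> m analytic_on {z}"
    and m_real_poles: "is_pole m z \<Longrightarrow> z \<in> \<real>"
begin

definition \<psi> :: "complex \<Rightarrow> int \<Rightarrow> complex" where
  "\<psi> z n = \<theta> z n + m z * \<phi> z n"

text \<open>
  The larger index is the smaller point of the lattice, which explains that \<open>\<phi>\<close> is taken at the maximum.
\<close>
definition green :: "complex \<Rightarrow> int \<Rightarrow> int \<Rightarrow> complex" where
  "green z n k = \<phi> z (max n k) * \<psi> z (min n k)"

lemma psi_sol: "solves z (\<psi> z)"
  unfolding \<psi>_def by (rule solves_linear[OF theta_sol phi_sol])

lemma casoratian_phi_psi: "casoratian (\<phi> z) (\<psi> z) n = 1"
proof -
  have "casoratian (\<phi> z) (\<psi> z) n = casoratian (\<phi> z) (\<theta> z) n"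
    by (simp add: casoratian_def \<psi>_def algebra_simps)
  then show ?thesis by (simp add: casoratian_phi_theta)
qed

lemma m_cnj:
  assumes "z \<notin> \<real>"
  shows "m (cnj z) = cnj (m z)"
proof (rule LIMSEQ_unique)
  have "cnj z \<notin> \<real>" using assms by (simp add: complex_is_Real_iff)
  from m_lim[OF this]
  show "(\<lambda>j. - (boundary_form (\<beta> j) (N j) (\<theta> (cnj z)) / boundary_form (\<beta> j) (N j) (\<phi> (cnj z)))) \<longlonglongrightarrow> m (cnj z)" .
  have "\<phi> (cnj z) = (\<lambda>n. cnj (\<phi> z n))" "\<theta> (cnj z) = (\<lambda>n. cnj (\<theta> z n))"
    by (auto simp: phi_cnj theta_cnj)
  then show "(\<lambda>j. - (boundary_form (\<beta> j) (N j) (\<theta> (cnj z)) / boundary_form (\<beta> j) (N j) (\<phi> (cnj z)))) \<longlonglongrightarrow> cnj (m z)"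
    using tendsto_cnj[OF m_lim[OF assms]] by (simp add: boundary_form_cnj)
qed

text \<open>
  Otherwise \<open>\<phi>\<close> would be an eigenfunction with non-real eigenvalue of a regular problem: its flux at \<open>k\<close> would vanish,
  hence so would its norm between \<open>0\<close> and \<open>q\<^sup>k\<close>.
\<close>
lemma boundary_form_phi_nonzero:
  assumes "z \<notin> \<real>"
  shows "boundary_form b k (\<phi> z) \<noteq> 0"
proof
  assume "boundary_form b k (\<phi> z) = 0"
  then have om0: "flux (\<phi> z) k = 0" by (rule boundary_form_zero_imp_flux_zero)
  have "\<phi> z n = 0" if "n \<ge> k" for n
  proof -
    have "(Im z)\<^sup>2 * (weight n * (cmod (\<phi> z n))\<^sup>2) \<le> 0"
      using flux_lower_bound[OF phi_sol phi_init that, of z] om0 by simp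
    moreover have "0 < (Im z)\<^sup>2" using assms by (simp add: complex_is_Real_iff)
    ultimately show ?thesis using weight_pos[of n]
      by (auto simp: mult_le_0_iff)
  qed
  then show False using phi_nonzero[of z k] by simp
qed

text \<open>
  The approximating solution \<open>\<theta> + l \<phi>\<close> satisfies a real boundary condition at a far point \<open>q powi N j\<close>, where its flux
  is zero; towards \<open>0\<close> the flux, multiplied by \<open>Im z\<close>, can only decrease. The sign survives the limit.
\<close>
lemma flux_psi_nonpos:
  assumes z: "z \<notin> \<real>"
  shows "Im z * flux (\<psi> z) n \<le> 0"
proof (rule tendsto_upperbound)
  define l where "l j = - (boundary_form (\<beta> j) (N j) (\<theta> z) / boundary_form (\<beta> j) (N j) (\<phi> z))" for j
  have l: "l \<longlonglongrightarrow> m z" using m_lim[OF z] by (simp add: l_def[abs_def])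
  show "(\<lambda>j. Im z * flux (\<lambda>n. \<theta> z n + l j * \<phi> z n) n) \<longlonglongrightarrow> Im z * flux (\<psi> z) n"
    unfolding flux_def \<psi>_def by (intro tendsto_intros l)
  have "eventually (\<lambda>j. N j \<le> n) sequentially"
    using N by (auto simp: filterlim_at_bot)
  then show "eventually (\<lambda>j. Im z * flux (\<lambda>n. \<theta> z n + l j * \<phi> z n) n \<le> 0) sequentially"
  proof eventually_elim
    case (elim j)
    have "boundary_form (\<beta> j) (N j) (\<lambda>n. \<theta> z n + l j * \<phi> z n) = 0"
      unfolding boundary_form_linear using boundary_form_phi_nonzero[OF z] by (simp add: l_def)
    from boundary_form_zero_imp_flux_zero[OF this]
    show ?case using flux_antimono[OF solves_linear[OF theta_sol phi_sol] elim, of z "l j"] by simp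
  qed
qed simp

lemma green_ge: "k \<le> n \<Longrightarrow> green z n k = \<phi> z n * \<psi> z k"
  and green_le: "n \<le> k \<Longrightarrow> green z n k = \<phi> z k * \<psi> z n"
  by (simp_all add: green_def max_absorb1 max_absorb2 min_absorb1 min_absorb2)

lemma green_commute: "green z n k = green z k n"
  by (simp add: green_def max.commute min.commute)

lemma green_bound:
  assumes "z \<notin> \<real>"
  shows "cmod (green z n k) \<le> 1 / sqrt (weight n * weight k) / \<bar>Im z\<bar>"
proof -
  have "Im z \<noteq> 0" using assms by (simp add: complex_is_Real_iff)
  then have le: "cmod (green z n k) \<le> 1 / sqrt (weight n * weight k) / \<bar>Im z\<bar>" if "k \<le> n" for n k
    using solution_product_bound[OF phi_sol phi_init casoratian_phi_psi flux_psi_nonpos[OF assms] that]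
    by (simp only: green_ge[OF that] simp_thms)
  show ?thesis
    using le[of k n] le[of n k] by (cases "k \<le> n") (auto simp: green_commute mult.commute)
qed

text \<open>
  So \<open>- green z k k\<close> is a Herglotz function of \<open>z\<close>; this is what makes the residues nonnegative.
\<close>
lemma green_herglotz:
  assumes "z \<notin> \<real>"
  shows "Im z * Im (green z k k) \<le> 0"
proof -
  have "0 \<le> (Im z)\<^sup>2 * (weight k * (cmod (\<phi> z k * \<psi> z k))\<^sup>2)" using weight_pos[of k] by simp
  also have "\<dots> \<le> - (Im z * Im (\<phi> z k * \<psi> z k))"
    by (rule flux_product_bound[OF phi_sol phi_init casoratian_phi_psi flux_psi_nonpos[OF assms] order_refl])
  finally show ?thesis by (simp add: green_def)
qed

text \<open>
  The operator \<open>L\<close> applied to the Green function in its first argument.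
\<close>
definition green_rest :: "complex \<Rightarrow> int \<Rightarrow> int \<Rightarrow> complex" where
  "green_rest z n k = of_real (V n) * green z n k - of_real (q powi (- 2 * n)) *
     (green z (n - 1) k - of_real ((1 + q) / q) * green z n k + of_real (1 / q) * green z (n + 1) k)"

lemma solves_operator_form:
  assumes "solves z u"
  shows "z * u n = of_real (V n) * u n - of_real (q powi (- 2 * n)) *
     (u (n - 1) - of_real ((1 + q) / q) * u n + of_real (1 / q) * u (n + 1))"
proof -
  have p: "complex_of_real (q powi (- 2 * n)) * of_real (q powi (2 * n)) = 1"
    by (simp add: power_int_minus flip: of_real_mult)
  define a b where "a = complex_of_real (q powi (2 * n))" and "b = complex_of_real ((1 + q) / q)"
  have "u (n - 1) - b * u n + of_real (1 / q) * u (n + 1) = a * ((of_real (V n) - z) * u n)"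
    unfolding assms[unfolded solves_def, rule_format, of n] a_def[symmetric] b_def[symmetric]
    by (simp add: algebra_simps)
  then have "of_real (q powi (- 2 * n)) * (u (n - 1) - b * u n + of_real (1 / q) * u (n + 1)) =
     (of_real (V n) - z) * u n"
    using p by (simp only: a_def mult.assoc[symmetric] mult_1_left)
  then show ?thesis unfolding b_def by (simp add: algebra_simps)
qed

text \<open>
  Off the diagonal the Green function is a solution in its first argument. On the diagonal the branch changes from
  \<open>\<phi>\<close> to \<open>\<psi>\<close>, and the defect is the casoratian of the two, which is \<open>1\<close>.
\<close>
lemma green_equation: "z * green z n k = (if n = k then of_real (1 / weight k) else 0) + green_rest z n k"
proof -
  consider "n > k" | "n < k" | "n = k" by linarith
  then show ?thesis
  proof cases
    case 1
    then have "green z n k = \<phi> z n * \<psi> z k" "green z (n - 1) k = \<phi> z (n - 1) * \<psi> z k" "green z (n + 1) k = \<phi> z (n + 1) * \<psi> z k"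
      by (simp_all add: green_ge green_le)
    then show ?thesis
      using 1 arg_cong[OF solves_operator_form[OF phi_sol, of z n], of "\<lambda>x. x * \<psi> z k"]
      unfolding green_rest_def by (simp only: algebra_simps) simp
  next
    case 2
    then have "green z n k = \<phi> z k * \<psi> z n" "green z (n - 1) k = \<phi> z k * \<psi> z (n - 1)" "green z (n + 1) k = \<phi> z k * \<psi> z (n + 1)"
      by (simp_all add: green_ge green_le)
    then show ?thesis
      using 2 arg_cong[OF solves_operator_form[OF psi_sol, of z n], of "\<lambda>x. x * \<phi> z k"]
      unfolding green_rest_def by (simp only: algebra_simps) simp
  next
    case 3
    have green: "green z k k = \<phi> z k * \<psi> z k" "green z (k - 1) k = \<phi> z k * \<psi> z (k - 1)" "green z (k + 1) k = \<phi> z (k + 1) * \<psi> z k"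
      by (simp_all add: green_ge green_le)
    define c where "c = complex_of_real (q powi (- 2 * k))"
    have "c * (\<phi> z k * \<psi> z (k - 1) - \<psi> z k * \<phi> z (k - 1)) = of_real (1 / weight k)"
    proof -
      have "q powi (- 2 * k) = q powi (- k) * q powi (- k)"
        by (subst power_int_add[symmetric]) auto
      moreover have "1 / weight k * (1 - q) = q powi (- k)"
        using q_less_1 by (simp add: weight_def power_int_minus field_simps)
      ultimately have "q powi (- 2 * k) = 1 / weight k * ((1 - q) * q powi (- k))"
        by (simp only: mult.assoc[symmetric])
      then have "c = of_real (1 / weight k) * of_real ((1 - q) * q powi (- k))"
        unfolding c_def of_real_mult[symmetric] by simp
      then have "c * (\<phi> z k * \<psi> z (k - 1) - \<psi> z k * \<phi> z (k - 1)) = of_real (1 / weight k) * casoratian (\<phi> z) (\<psi> z) k"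
        by (simp only: casoratian_def mult.assoc)
      then show ?thesis by (simp add: casoratian_phi_psi)
    qed
    moreover have "z * (\<phi> z k * \<psi> z k) = of_real (V k) * (\<phi> z k * \<psi> z k) - c *
     (\<phi> z (k - 1) * \<psi> z k - of_real ((1 + q) / q) * (\<phi> z k * \<psi> z k) + of_real (1 / q) * (\<phi> z (k + 1) * \<psi> z k))"
      using arg_cong[OF solves_operator_form[OF phi_sol, of z k], of "\<lambda>x. x * \<psi> z k"]
      unfolding c_def by (simp only: algebra_simps)
    ultimately show ?thesis
      unfolding green_rest_def 3 green c_def[symmetric] by (simp add: algebra_simps)
  qed
qed

lemma green_rest_bound: "\<exists>C. \<forall>z. z \<notin> \<real> \<longrightarrow> cmod (green_rest z n k) \<le> C / \<bar>Im z\<bar>"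
proof -
  define g where "g n = 1 / sqrt (weight n * weight k)" for n
  define C where "C = \<bar>V n\<bar> * g n + \<bar>q powi (- 2 * n)\<bar> * (g (n - 1) + \<bar>(1 + q) / q\<bar> * g n + \<bar>1 / q\<bar> * g (n + 1))"
  have "cmod (green_rest z n k) \<le> C / \<bar>Im z\<bar>" if "z \<notin> \<real>" for z
  proof -
    have green: "cmod (green z n k) \<le> g n / \<bar>Im z\<bar>" for n unfolding g_def by (rule green_bound[OF that])
    have "cmod (green_rest z n k) \<le> \<bar>V n\<bar> * cmod (green z n k) + \<bar>q powi (- 2 * n)\<bar> *
        (cmod (green z (n - 1) k) + \<bar>(1 + q) / q\<bar> * cmod (green z n k) + \<bar>1 / q\<bar> * cmod (green z (n + 1) k))"
      unfolding green_rest_def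
      by (intro order_trans[OF norm_triangle_ineq4] order_trans[OF norm_triangle_ineq] add_mono norm_mult_ineq
           order_trans[OF norm_mult_ineq] mult_mono) (auto simp: norm_mult simp del: of_real_add of_real_divide of_real_power_int)
    also have "\<dots> \<le> \<bar>V n\<bar> * (g n / \<bar>Im z\<bar>) + \<bar>q powi (- 2 * n)\<bar> *
        (g (n - 1) / \<bar>Im z\<bar> + \<bar>(1 + q) / q\<bar> * (g n / \<bar>Im z\<bar>) + \<bar>1 / q\<bar> * (g (n + 1) / \<bar>Im z\<bar>))"
      by (intro add_mono mult_left_mono green abs_ge_zero)
    also have "\<dots> = C / \<bar>Im z\<bar>"
      by (simp add: C_def add_divide_distrib distrib_left)
    finally show ?thesis .
  qed
  then show ?thesis by blast
qed

end

section \<open>Poles, residues and completeness of the eigenfunctions\<close>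

text \<open>
  Near a real pole the Green function is controlled along the vertical line through the pole, where the distance to
  the pole equals \<open>\<bar>Im z\<bar>\<close>.
\<close>
lemma ray_tendsto:
  fixes l c :: complex
  assumes "c \<noteq> 0"
  shows "filterlim (\<lambda>t. l + of_real t * c) (at l) (at_right 0)"
  unfolding filterlim_at
proof
  show "eventually (\<lambda>t. l + of_real t * c \<in> UNIV \<and> l + of_real t * c \<noteq> l) (at_right 0)"
    using assms by (auto simp: eventually_at_filter intro!: always_eventually)
  have "((\<lambda>t. l + of_real t * c) \<longlongrightarrow> l + of_real 0 * c) (at_right 0)"
    by (intro tendsto_intros)
  then show "((\<lambda>t. l + of_real t * c) \<longlongrightarrow> l) (at_right 0)" by simp
qed

lemma ray_not_real: "l \<in> \<real> \<Longrightarrow> t \<noteq> 0 \<Longrightarrow> l + of_real t * \<i> \<notin> \<real>"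
  and Im_ray: "l \<in> \<real> \<Longrightarrow> Im (l + of_real t * \<i>) = t"
  by (auto simp: complex_is_Real_iff)

context q_weyl
begin

abbreviation poles :: "complex set" where "poles \<equiv> {z. is_pole m z}"

lemma m_isolated: "isolated_singularity_at m z"
  by (rule meromorphic_on_isolated_singularity, rule meromorphic_on_subset[OF m_meromorphic]) simp

lemma poles_discrete: "\<not> z islimpt poles"
  by (rule not_islimpt_poles[OF m_isolated])

lemma m_holomorphic: "m holomorphic_on - poles"
proof -
  have "m analytic_on - poles"
    using m_analytic by (subst analytic_on_analytic_at) auto
  then show ?thesis by (rule analytic_imp_holomorphic)
qed

lemma phi_tendsto: "((\<lambda>z. \<phi> z n) \<longlongrightarrow> \<phi> l n) (at l)"
  using holomorphic_on_imp_continuous_on[OF phi_holomorphic[of n UNIV]]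
  by (simp add: continuous_on_def)

lemma theta_tendsto: "((\<lambda>z. \<theta> z n) \<longlongrightarrow> \<theta> l n) (at l)"
  using holomorphic_on_imp_continuous_on[OF theta_holomorphic[of n UNIV]]
  by (simp add: continuous_on_def)

lemma green_diag: "green z k k = \<phi> z k * \<theta> z k + m z * (\<phi> z k)\<^sup>2"
  by (simp add: green_def \<psi>_def algebra_simps power2_eq_square)

text \<open>
  The product \<open>t * green (l + t \<i>) k k\<close> stays bounded as \<open>t\<close> decreases to \<open>0\<close>. If \<open>k\<close> is chosen such that
  \<open>\<phi> l k\<close> is nonzero, the same follows for \<open>t * m (l + t \<i>)\<close>, which rules out poles of order two or more.
\<close>
lemma m_simple_pole:
  assumes l: "is_pole m l"
  shows "((\<lambda>z. m z * (z - l)) \<longlongrightarrow> residue m l) (at l)"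
proof -
  have lR: "l \<in> \<real>" by (rule m_real_poles[OF l])
  obtain k where k: "\<phi> l k \<noteq> 0" using phi_nonzero by blast
  define M where "M = nat (- zorder m l)"
  define g where "g = zor_poly m l"
  have "closed (poles - {l})"
    unfolding closed_limpt using poles_discrete islimpt_subset[of _ "poles - {l}" poles] by blast
  then have S: "open (- (poles - {l}))" by (rule open_Compl)
  have "m holomorphic_on - (poles - {l}) - {l}"
    by (rule holomorphic_on_subset[OF m_holomorphic]) auto
  from zorder_exist_pole[OF this S _ l] obtain r where
    neg: "zorder m l < 0" and g0: "g l \<noteq> 0" and r: "r > 0" "g holomorphic_on cball l r"
      "\<And>w. w \<in> cball l r - {l} \<Longrightarrow> m w = g w / (w - l) ^ M"
    unfolding g_def M_def by auto
  have "isCont g l"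
    using holomorphic_on_imp_continuous_on[OF r(2)] r(1) by (intro continuous_on_interior) auto
  then have g_lim: "(g \<longlongrightarrow> g l) (at l)" by (simp add: isCont_def)
  have near: "eventually (\<lambda>w. w \<in> cball l r - {l}) (at l)"
    using eventually_at_ball'[OF r(1), of l UNIV] by eventually_elim auto
  have "M = 1"
  proof (rule ccontr)
    assume "M \<noteq> 1"
    with neg have M: "M = Suc (Suc (M - 2))" unfolding M_def by linarith
    \<comment> \<open>With \<open>M \<ge> 2\<close> the leading coefficient at the pole is a limit of bounded quantities times \<open>t ^ (M - 1)\<close>.\<close>
    let ?v = "\<lambda>t::real. l + of_real t * \<i>"
    have ray: "filterlim ?v (at l) (at_right 0)" by (rule ray_tendsto) simp
    have "((\<lambda>t. g (?v t) * (\<phi> (?v t) k)\<^sup>2) \<longlongrightarrow> g l * (\<phi> l k)\<^sup>2) (at_right 0)"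
      by (intro tendsto_intros filterlim_compose[OF g_lim ray] filterlim_compose[OF phi_tendsto ray])
    moreover have "((\<lambda>t. g (?v t) * (\<phi> (?v t) k)\<^sup>2) \<longlongrightarrow> 0) (at_right 0)"
    proof (rule Lim_null_comparison)
      have "((\<lambda>t. (1 / weight k + t * cmod (\<phi> (?v t) k * \<theta> (?v t) k)) * t ^ Suc (M - 2)) \<longlongrightarrow>
          (1 / weight k + 0 * cmod (\<phi> l k * \<theta> l k)) * 0 ^ Suc (M - 2)) (at_right 0)"
        by (intro tendsto_intros filterlim_compose[OF theta_tendsto ray] filterlim_compose[OF phi_tendsto ray])
      then show "((\<lambda>t. (1 / weight k + t * cmod (\<phi> (?v t) k * \<theta> (?v t) k)) * t ^ Suc (M - 2)) \<longlongrightarrow> 0) (at_right 0)"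
        by simp
      have "eventually (\<lambda>t. ?v t \<in> cball l r - {l}) (at_right 0)"
        by (rule eventually_compose_filterlim[OF near ray])
      moreover have "eventually (\<lambda>t::real. t > 0) (at_right 0)" by (simp add: eventually_at_filter)
      ultimately show "eventually (\<lambda>t. cmod (g (?v t) * (\<phi> (?v t) k)\<^sup>2)
          \<le> (1 / weight k + t * cmod (\<phi> (?v t) k * \<theta> (?v t) k)) * t ^ Suc (M - 2)) (at_right 0)"
      proof eventually_elim
        case (elim t)
        let ?z = "?v t"
        have "g ?z = m ?z * (of_real t * \<i>) ^ M" using r(3)[OF elim(1)] elim(2) by simp
        also have "(of_real t * \<i>) ^ M = of_real t * (of_real t ^ Suc (M - 2) * \<i> ^ M)"
          unfolding power_mult_distrib mult.assoc[symmetric] power_Suc[symmetric] M[symmetric] ..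
        finally have "g ?z * (\<phi> ?z k)\<^sup>2 = of_real t * (green ?z k k - \<phi> ?z k * \<theta> ?z k) * (of_real t ^ Suc (M - 2) * \<i> ^ M)"
          by (simp add: green_diag mult_ac)
        then have "cmod (g ?z * (\<phi> ?z k)\<^sup>2) = t * cmod (green ?z k k - \<phi> ?z k * \<theta> ?z k) * t ^ Suc (M - 2)"
          using elim(2) by (simp add: norm_mult norm_power)
        also have "\<dots> \<le> t * (1 / weight k / t + cmod (\<phi> ?z k * \<theta> ?z k)) * t ^ Suc (M - 2)"
        proof (intro mult_right_mono mult_left_mono order_trans[OF norm_triangle_ineq4] add_mono order_refl)
          have "cmod (green ?z k k) \<le> 1 / sqrt (weight k * weight k) / \<bar>Im ?z\<bar>"
            using elim(2) by (intro green_bound ray_not_real lR) auto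
          then show "cmod (green ?z k k) \<le> 1 / weight k / t"
            using Im_ray[OF lR, of t] elim(2) weight_pos[of k] by simp
        qed (use elim in auto)
        also have "t * (1 / weight k / t + cmod (\<phi> ?z k * \<theta> ?z k)) = 1 / weight k + t * cmod (\<phi> ?z k * \<theta> ?z k)"
          using elim(2) by (simp add: distrib_left)
        finally show ?case .
      qed
    qed
    ultimately have "g l * (\<phi> l k)\<^sup>2 = 0"
      by (rule tendsto_unique[rotated]) simp
    then show False using k g0 by simp
  qed
  then have "zorder m l = - 1" using neg unfolding M_def by linarith
  from residue_simple_pole[OF m_isolated l this] have "residue m l = g l" by (simp add: g_def)
  moreover have "((\<lambda>z. m z * (z - l)) \<longlongrightarrow> g l) (at l)"
  proof (rule Lim_transform_eventually[OF g_lim])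
    show "eventually (\<lambda>w. g w = m w * (w - l)) (at l)"
      using near by eventually_elim (use r(3) \<open>M = 1\<close> in auto)
  qed
  ultimately show ?thesis by simp
qed

text \<open>
  Approaching \<open>l\<close> vertically from above and from below gives conjugate limits, because \<open>m\<close> commutes with
  conjugation; so the residue is real. Its sign is read off from the Herglotz property of the diagonal Green function.
\<close>
lemma residue_real_nonneg:
  assumes l: "is_pole m l"
  shows "residue m l \<in> \<real>" "0 \<le> Re (residue m l)"
proof -
  have lR: "l \<in> \<real>" by (rule m_real_poles[OF l])
  let ?v = "\<lambda>t::real. l + of_real t * \<i>"
  have ray: "filterlim ?v (at l) (at_right 0)" by (rule ray_tendsto) simp
  have ray': "filterlim (\<lambda>t. l + of_real t * (- \<i>)) (at l) (at_right 0)" by (rule ray_tendsto) simp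
  have pos: "eventually (\<lambda>t::real. t > 0) (at_right 0)" by (simp add: eventually_at_filter)
  have lim: "((\<lambda>t. m (?v t) * (of_real t * \<i>)) \<longlongrightarrow> residue m l) (at_right 0)"
    using filterlim_compose[OF m_simple_pole[OF l] ray] by simp
  have "((\<lambda>t. m (l + of_real t * (- \<i>)) * (of_real t * (- \<i>))) \<longlongrightarrow> residue m l) (at_right 0)"
    using filterlim_compose[OF m_simple_pole[OF l] ray'] by simp
  moreover have "((\<lambda>t. m (l + of_real t * (- \<i>)) * (of_real t * (- \<i>))) \<longlongrightarrow> cnj (residue m l)) (at_right 0)"
  proof (rule Lim_transform_eventually[OF tendsto_cnj[OF lim]])
    show "eventually (\<lambda>t. cnj (m (?v t) * (of_real t * \<i>)) = m (l + of_real t * (- \<i>)) * (of_real t * (- \<i>))) (at_right 0)"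
      using pos
    proof eventually_elim
      case (elim t)
      have "m (cnj (?v t)) = cnj (m (?v t))" using elim by (intro m_cnj ray_not_real lR) auto
      moreover have "cnj (?v t) = l + of_real t * (- \<i>)" using lR by (simp add: Reals_cnj_iff)
      ultimately show ?case by simp
    qed
  qed
  ultimately have "residue m l = cnj (residue m l)" by (rule tendsto_unique[rotated]) simp
  then show real: "residue m l \<in> \<real>" by (simp add: Reals_cnj_iff)
  obtain k where k: "\<phi> l k \<noteq> 0" using phi_nonzero by blast
  have "((\<lambda>t. (\<phi> (?v t) k * \<theta> (?v t) k) * (of_real t * \<i>) + m (?v t) * (of_real t * \<i>) * (\<phi> (?v t) k)\<^sup>2)
      \<longlongrightarrow> (\<phi> l k * \<theta> l k) * (of_real 0 * \<i>) + residue m l * (\<phi> l k)\<^sup>2) (at_right 0)"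
    by (intro tendsto_intros lim filterlim_compose[OF theta_tendsto ray] filterlim_compose[OF phi_tendsto ray])
  moreover have "(\<phi> z k * \<theta> z k) * w + m z * w * (\<phi> z k)\<^sup>2 = green z k k * w" for z w
    by (simp add: green_diag algebra_simps)
  ultimately have "((\<lambda>t. green (?v t) k k * (of_real t * \<i>)) \<longlongrightarrow> residue m l * (\<phi> l k)\<^sup>2) (at_right 0)"
    by (simp only: mult_zero_left mult_zero_right of_real_0 add_0_left)
  then have "((\<lambda>t. Re (green (?v t) k k * (of_real t * \<i>))) \<longlongrightarrow> Re (residue m l * (\<phi> l k)\<^sup>2)) (at_right 0)"
    by (rule tendsto_Re)
  moreover have "eventually (\<lambda>t. 0 \<le> Re (green (?v t) k k * (of_real t * \<i>))) (at_right 0)"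
    using pos
  proof eventually_elim
    case (elim t)
    have "Im (?v t) * Im (green (?v t) k k) \<le> 0" using elim by (intro green_herglotz ray_not_real lR) auto
    then have "t * Im (green (?v t) k k) \<le> 0" unfolding Im_ray[OF lR] .
    then show ?case by (simp add: mult.commute)
  qed
  ultimately have "0 \<le> Re (residue m l * (\<phi> l k)\<^sup>2)"
    by (intro tendsto_lowerbound[of _ _ "at_right 0"]) auto
  moreover have "\<phi> l k = of_real (Re (\<phi> l k))" using phi_real[OF lR] by simp
  then obtain x where x: "\<phi> l k = of_real x" by blast
  ultimately have "0 \<le> Re (residue m l) * x\<^sup>2" by (simp flip: of_real_power)
  moreover have "0 < x\<^sup>2" using k x by simp
  ultimately show "0 \<le> Re (residue m l)" by (simp add: zero_le_mult_iff)
qed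

text \<open>
  Only the part \<open>m z * \<phi> z n * \<phi> z k\<close> is singular, which is also why the residue is symmetric in \<open>n\<close> and \<open>k\<close>.
\<close>
lemma green_residue:
  assumes "is_pole m p"
  shows "((\<lambda>z. green z n k * (z - p)) \<longlongrightarrow> residue m p * (\<phi> p n * \<phi> p k)) (at p)"
proof -
  let ?a = "max n k" and ?b = "min n k"
  have "((\<lambda>z. \<phi> z ?a * \<theta> z ?b * (z - p) + m z * (z - p) * (\<phi> z ?a * \<phi> z ?b))
     \<longlongrightarrow> \<phi> p ?a * \<theta> p ?b * (p - p) + residue m p * (\<phi> p ?a * \<phi> p ?b)) (at p)"
    by (intro tendsto_intros m_simple_pole[OF assms] theta_tendsto phi_tendsto)
  moreover have "\<phi> p ?a * \<phi> p ?b = \<phi> p n * \<phi> p k"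
    by (auto simp: max_def min_def)
  ultimately show ?thesis by (simp add: green_def \<psi>_def algebra_simps)
qed

lemma green_holomorphic: "(\<lambda>z. green z n k) holomorphic_on - poles"
  unfolding green_def \<psi>_def by (intro holomorphic_intros m_holomorphic phi_holomorphic theta_holomorphic)

lemma spectral_riesz_mean:
  "\<exists>K. \<forall>R>0. (\<forall>p\<in>poles. cmod p \<noteq> R) \<longrightarrow>
     cmod ((\<Sum>p\<in>poles \<inter> ball 0 R. (1 - p\<^sup>2 / of_real (R\<^sup>2)) * (residue m p * (\<phi> p n * \<phi> p k)))
         - (if n = k then of_real (1 / weight k) else 0)) \<le> K / R"
proof -
  obtain C where C: "\<And>z. z \<notin> \<real> \<Longrightarrow> cmod (green_rest z n k) \<le> C / \<bar>Im z\<bar>" using green_rest_bound by blast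
  have b: "cmod (z * green z n k - (if n = k then of_real (1 / weight k) else 0)) \<le> C / \<bar>Im z\<bar>" if "z \<notin> \<real>" for z
    using C[OF that] unfolding green_equation by simp
  show ?thesis
    using residue_riesz_mean[OF green_holomorphic poles_discrete _ b] green_residue
    by (intro exI[of _ "2 * C"]) auto
qed

end

locale q_weyl_enum = q_weyl +
  fixes ev :: "nat \<Rightarrow> complex"
  assumes ev: "bij_betw ev UNIV poles"
begin

text \<open>
  The function \<open>\<psi>\<^sub>n\<close> in sequence form. It is introduced as a real quantity, since residues and eigenfunctions are real at the poles.
\<close>
definition eigenvec :: "nat \<Rightarrow> int \<Rightarrow> real" where
  "eigenvec n k = sqrt (Re (residue m (ev n))) * Re (\<phi> (ev n) k)"

lemma ev_pole: "is_pole m (ev n)"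
  using ev by (auto simp: bij_betw_def)

lemma eigenvec_mult: "residue m (ev n) * (\<phi> (ev n) i * \<phi> (ev n) k) = of_real (eigenvec n i * eigenvec n k)"
proof -
  have r: "residue m (ev n) = of_real (Re (residue m (ev n)))" "0 \<le> Re (residue m (ev n))"
    using residue_real_nonneg[OF ev_pole, of n] by auto
  have p: "\<phi> (ev n) j = of_real (Re (\<phi> (ev n) j))" for j
    using phi_real[OF m_real_poles[OF ev_pole]] by simp
  have "eigenvec n i * eigenvec n k = Re (residue m (ev n)) * (Re (\<phi> (ev n) i) * Re (\<phi> (ev n) k))"
    using r(2) by (simp add: eigenvec_def)
  then show ?thesis by (subst r(1), subst p[of i], subst p[of k]) simp
qed

lemma bij_below: "bij_betw ev {n. cmod (ev n) < R} (poles \<inter> ball 0 R)"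
proof (rule bij_betw_subset[OF ev])
  have "ev ` {n. cmod (ev n) < R} = range ev \<inter> ball 0 R" by auto
  then show "ev ` {n. cmod (ev n) < R} = poles \<inter> ball 0 R"
    by (simp only: bij_betw_imp_surj_on[OF ev])
qed simp

lemma finite_below: "finite {n. cmod (ev n) < R}"
proof -
  have "finite (cball 0 R \<inter> poles)"
    using poles_discrete by (intro finite_not_islimpt_in_compact) auto
  then have "finite (poles \<inter> ball 0 R)" by (rule rev_finite_subset) auto
  then show ?thesis using bij_betw_finite[OF bij_below] by blast
qed

lemma eigenvec_riesz_mean:
  "\<exists>K. \<forall>R>0. R \<notin> range (\<lambda>n. cmod (ev n)) \<longrightarrow>
     \<bar>(\<Sum>n | cmod (ev n) < R. (1 - (cmod (ev n))\<^sup>2 / R\<^sup>2) * (eigenvec n i * eigenvec n k))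
         - (if i = k then 1 / weight k else 0)\<bar> \<le> K / R"
proof -
  obtain K where K: "\<And>R. R > 0 \<Longrightarrow> (\<forall>p\<in>poles. cmod p \<noteq> R) \<Longrightarrow>
     cmod ((\<Sum>p\<in>poles \<inter> ball 0 R. (1 - p\<^sup>2 / of_real (R\<^sup>2)) * (residue m p * (\<phi> p i * \<phi> p k)))
         - (if i = k then of_real (1 / weight k) else 0)) \<le> K / R"
    using spectral_riesz_mean by blast
  have sq: "(ev n)\<^sup>2 = of_real ((cmod (ev n))\<^sup>2)" for n
    using m_real_poles[OF ev_pole, of n] unfolding cmod_power2
    by (simp add: complex_is_Real_iff complex_eq_iff power2_eq_square)
  have "\<bar>(\<Sum>n | cmod (ev n) < R. (1 - (cmod (ev n))\<^sup>2 / R\<^sup>2) * (eigenvec n i * eigenvec n k))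
         - (if i = k then 1 / weight k else 0)\<bar> \<le> K / R"
    if R: "R > 0" "R \<notin> range (\<lambda>n. cmod (ev n))" for R
  proof -
    have "\<forall>p\<in>poles. cmod p \<noteq> R"
    proof
      fix p assume "p \<in> poles"
      then obtain n where "p = ev n" using ev by (auto simp: bij_betw_def)
      then show "cmod p \<noteq> R" using R by auto
    qed
    note K[OF R(1) this]
    also have "(\<Sum>p\<in>poles \<inter> ball 0 R. (1 - p\<^sup>2 / of_real (R\<^sup>2)) * (residue m p * (\<phi> p i * \<phi> p k)))
        = (\<Sum>n | cmod (ev n) < R. (1 - (ev n)\<^sup>2 / of_real (R\<^sup>2)) * (residue m (ev n) * (\<phi> (ev n) i * \<phi> (ev n) k)))"
      by (rule sum.reindex_bij_betw[OF bij_below, symmetric])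
    also have "\<dots> = of_real (\<Sum>n | cmod (ev n) < R. (1 - (cmod (ev n))\<^sup>2 / R\<^sup>2) * (eigenvec n i * eigenvec n k))"
      unfolding eigenvec_mult sq by simp
    also have "(if i = k then complex_of_real (1 / weight k) else 0) = of_real (if i = k then 1 / weight k else 0)"
      by simp
    finally show ?thesis by (simp only: of_real_diff[symmetric] norm_of_real)
  qed
  then show ?thesis by blast
qed

text \<open>
  Positivity on the diagonal gives summability there, and the inequality between geometric and arithmetic mean
  extends it to absolute summability off the diagonal.
\<close>
lemma eigenvec_completeness: "(\<lambda>n. eigenvec n i * eigenvec n k) sums (if i = k then 1 / weight k else 0)"
proof -
  have sm: "summable (\<lambda>n. eigenvec n j * eigenvec n j)" for j
  proof -
    from eigenvec_riesz_mean[of j j] obtain K where K: "\<And>R. R > 0 \<Longrightarrow> R \<notin> range (\<lambda>n. cmod (ev n)) \<Longrightarrow>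
       \<bar>(\<Sum>n | cmod (ev n) < R. (1 - (cmod (ev n))\<^sup>2 / R\<^sup>2) * (eigenvec n j * eigenvec n j))
         - (if j = j then 1 / weight j else 0)\<bar> \<le> K / R" by blast
    show ?thesis by (rule riesz_means_summable[OF finite_below _ _ K]) auto
  qed
  have "summable (\<lambda>n. \<bar>eigenvec n i * eigenvec n k\<bar>)"
  proof (rule summable_comparison_test'[OF summable_add[OF sm[of i] sm[of k]]])
    fix n :: nat
    have "2 * (\<bar>eigenvec n i\<bar> * \<bar>eigenvec n k\<bar>) \<le> eigenvec n i * eigenvec n i + eigenvec n k * eigenvec n k"
      using sum_squares_bound[of "\<bar>eigenvec n i\<bar>" "\<bar>eigenvec n k\<bar>"] by (simp add: power2_eq_square)
    moreover have "0 \<le> \<bar>eigenvec n i\<bar> * \<bar>eigenvec n k\<bar>" by simp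
    ultimately have "\<bar>eigenvec n i\<bar> * \<bar>eigenvec n k\<bar> \<le> eigenvec n i * eigenvec n i + eigenvec n k * eigenvec n k" by linarith
    then show "norm \<bar>eigenvec n i * eigenvec n k\<bar> \<le> eigenvec n i * eigenvec n i + eigenvec n k * eigenvec n k"
      by (simp add: abs_mult)
  qed
  note sm_mult = this
  from eigenvec_riesz_mean[of i k] obtain K where K: "\<And>R. R > 0 \<Longrightarrow> R \<notin> range (\<lambda>n. cmod (ev n)) \<Longrightarrow>
       \<bar>(\<Sum>n | cmod (ev n) < R. (1 - (cmod (ev n))\<^sup>2 / R\<^sup>2) * (eigenvec n i * eigenvec n k))
         - (if i = k then 1 / weight k else 0)\<bar> \<le> K / R" by blast
  show ?thesis by (rule riesz_means_sums[OF finite_below _ sm_mult K]) auto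
qed

text \<open>
  Splitting the weight into two square roots turns the completeness relation into dual orthonormality.
\<close>
lemma eigenvec_parseval:
  fixes g :: "int \<Rightarrow> complex"
  assumes "(\<lambda>k. weight k * (cmod (g k))\<^sup>2) summable_on UNIV"
  shows "(\<lambda>n. (\<Sum>\<^sub>\<infinity>k. of_real (weight k) * (of_real (eigenvec n k) * g k))\<^sup>2) sums (\<Sum>\<^sub>\<infinity>k. of_real (weight k) * (g k)\<^sup>2)"
proof -
  have w: "sqrt (weight k) * sqrt (weight k) = weight k" "0 \<le> weight k" for k
    using weight_pos[of k] by auto
  interpret dual_orthonormal "\<lambda>n k. eigenvec n k * sqrt (weight k)"
  proof
    fix i k
    have "(\<lambda>n. eigenvec n i * eigenvec n k * (sqrt (weight i) * sqrt (weight k))) sums ((if i = k then 1 / weight k else 0) * (sqrt (weight i) * sqrt (weight k)))"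
      by (intro sums_mult2 eigenvec_completeness)
    moreover have "(if i = k then 1 / weight k else 0) * (sqrt (weight i) * sqrt (weight k)) = (if i = k then 1 else 0)"
      using w(1)[of k] weight_pos[of k] by auto
    ultimately show "(\<lambda>n. eigenvec n i * sqrt (weight i) * (eigenvec n k * sqrt (weight k))) sums (if i = k then 1 else 0)"
      by (simp add: mult_ac)
  qed
  have 1: "(\<lambda>k. (cmod (of_real (sqrt (weight k)) * g k))\<^sup>2) summable_on UNIV"
    using assms w by (simp add: norm_mult power_mult_distrib)
  have wc: "of_real (sqrt (weight k)) * of_real (sqrt (weight k)) = (of_real (weight k) :: complex)" for k
    unfolding of_real_mult[symmetric] w(1) ..
  have 2: "of_real (eigenvec n k * sqrt (weight k)) * (of_real (sqrt (weight k)) * g k) = of_real (weight k) * (of_real (eigenvec n k) * g k)" for n k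
    by (simp only: of_real_mult wc[symmetric] mult_ac)
  have 3: "(of_real (sqrt (weight k)) * g k)\<^sup>2 = of_real (weight k) * (g k)\<^sup>2" for k
    by (simp only: power2_eq_square wc[symmetric] mult_ac)
  show ?thesis using parseval_complex[OF 1] unfolding 2 3 .
qed

end

section \<open>Passage from functions on the powers of q to sequences\<close>

context q_lattice
begin

lemma powi_Suc: "q * q powi n = q powi (n + 1)" and powi_pred: "inverse q * q powi n = q powi (n - 1)"
  by (simp_all add: power_int_add power_int_diff field_simps)

lemma solves_of_is_solution:
  assumes "is_solution q W z F" "\<And>n. V n = W (q powi n)"
  shows "solves z (\<lambda>n. F (q powi n))"
  unfolding solves_def
proof
  fix n
  define x where "x = q powi n"
  have x: "x \<noteq> 0" by (simp add: x_def)
  have "q powi (2 * n) = x\<^sup>2"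
    unfolding x_def power2_eq_square mult_2 by (subst power_int_add) auto
  moreover have "x \<in> Rq q" by (simp add: x_def Rq_def)
  with assms(1) have "q_laplace q F x + (z - of_real (W x)) * F x = 0"
    by (simp add: is_solution_def)
  then have lap: "(of_real (W x) - z) * F x = q_laplace q F x"
    by algebra
  define b where "b = complex_of_real ((1 + q) / q)"
  have inv: "complex_of_real (x\<^sup>2) * complex_of_real (1 / x\<^sup>2) = 1"
    using x by (simp flip: of_real_mult)
  have "of_real (x\<^sup>2) * ((of_real (W x) - z) * F x) = F (inverse q * x) - b * F x + of_real (1 / q) * F (q * x)"
    unfolding lap q_laplace_def b_def mult.assoc[symmetric] inv by simp
  then have "F (inverse q * x) = (b + of_real (x\<^sup>2) * (of_real (W x) - z)) * F x - F (q * x) / of_real q"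
    by (simp add: algebra_simps)
  then have "F (inverse q * x) = (of_real ((1 + q) / q) + of_real (x\<^sup>2) * (of_real (W x) - z)) * F x - F (q * x) / of_real q"
    unfolding b_def .
  ultimately show "F (q powi (n - 1)) = (of_real ((1 + q) / q) + of_real (q powi (2 * n)) * (of_real (V n) - z)) * F (q powi n)
      - F (q powi (n + 1)) / of_real q"
    by (simp only: x_def powi_Suc powi_pred assms(2))
qed

lemma initial_values_of_has_initial_values:
  "has_initial_values q F v d \<Longrightarrow> initial_values (\<lambda>n. F (q powi n)) v d"
  by (simp add: has_initial_values_def initial_values_def)

lemma weyl_l_lattice:
  "weyl_l q \<phi> \<theta> z (q powi n) b = - (boundary_form b n (\<lambda>n. \<theta> z (q powi n)) / boundary_form b n (\<lambda>n. \<phi> z (q powi n)))"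
proof -
  have "q_shift_inv q (q_deriv q F) (q powi n) = (F (q powi (n - 1)) - F (q powi n)) * of_real (q powi (1 - n) / (1 - q))" for F
  proof -
    have "q powi (1 - n) = inverse (q powi (n - 1))"
      by (simp flip: power_int_minus)
    then show ?thesis
      by (simp add: q_shift_inv_def q_deriv_def powi_pred powi_Suc divide_inverse mult_ac)
  qed
  then show ?thesis by (simp add: weyl_l_def boundary_form_def mult.assoc)
qed

end

text \<open>
  Unifies the two cases in the definition of \<open>m\<close>: if \<open>m z\<close> is a limit point, the whole circles shrink to it, so every
  choice of points on them converges to it, in particular the one that serves the limit-circle case.
\<close>
lemma weyl_m_function_lattice:
  assumes "weyl_m_function q \<phi> \<theta> m" "0 < q" "q < 1"
  obtains N :: "nat \<Rightarrow> int" and \<beta> :: "nat \<Rightarrow> real"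
  where "filterlim N at_bot sequentially"
    "\<And>z. z \<notin> \<real> \<Longrightarrow> (\<lambda>j. weyl_l q \<phi> \<theta> z (q powi N j) (\<beta> j)) \<longlonglongrightarrow> m z"
proof -
  from assms(1) obtain b \<beta> where b: "\<And>j. b j \<in> Rq q" "filterlim b at_top sequentially"
    and lim: "\<And>z. z \<notin> \<real> \<Longrightarrow> weyl_limit_point q \<phi> \<theta> z (m z) \<or> (\<lambda>j. weyl_l q \<phi> \<theta> z (b j) (\<beta> j)) \<longlonglongrightarrow> m z"
    unfolding weyl_m_function_def by blast
  from b(1) have "\<exists>n. b j = q powi n" for j by (auto simp: Rq_def)
  then obtain N where N: "\<And>j. b j = q powi N j" by metis
  show thesis
  proof
    show "filterlim N at_bot sequentially"
      unfolding filterlim_at_bot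
    proof
      fix M
      have "eventually (\<lambda>j. b j > q powi (M + 1)) sequentially"
        using b(2) by (auto simp: filterlim_at_top_dense)
      then show "eventually (\<lambda>j. N j \<le> M) sequentially"
      proof eventually_elim
        case (elim j)
        show ?case
        proof (rule ccontr)
          assume "\<not> N j \<le> M"
          then have "q powi N j \<le> q powi (M + 1)"
            using assms(2,3) by (intro power_int_decreasing) auto
          then show False using elim N[of j] by simp
        qed
      qed
    qed
    fix z :: complex assume "z \<notin> \<real>"
    from lim[OF this] have "(\<lambda>j. weyl_l q \<phi> \<theta> z (b j) (\<beta> j)) \<longlonglongrightarrow> m z"
    proof
      assume lp: "weyl_limit_point q \<phi> \<theta> z (m z)"
      show ?thesis
        unfolding tendsto_iff
      proof (intro allI impI)
        fix e :: real assume "e > 0"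
        with lp obtain B where B: "\<And>b. b \<in> Rq q \<Longrightarrow> b \<ge> B \<Longrightarrow> weyl_circle q \<phi> \<theta> z b \<subseteq> ball (m z) e"
          unfolding weyl_limit_point_def by blast
        have "eventually (\<lambda>j. b j \<ge> B) sequentially" using b(2) by (auto simp: filterlim_at_top)
        then show "eventually (\<lambda>j. dist (weyl_l q \<phi> \<theta> z (b j) (\<beta> j)) (m z) < e) sequentially"
        proof eventually_elim
          case (elim j)
          have "weyl_l q \<phi> \<theta> z (b j) (\<beta> j) \<in> weyl_circle q \<phi> \<theta> z (b j)"
            by (simp add: weyl_circle_def)
          with B[OF b(1) elim] show ?case by (auto simp: dist_commute)
        qed
      qed
    qed
    then show "(\<lambda>j. weyl_l q \<phi> \<theta> z (q powi N j) (\<beta> j)) \<longlonglongrightarrow> m z" by (simp add: N)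
  qed
qed

theorem theorem2:
  fixes q \<alpha> :: real
    and V :: "real \<Rightarrow> real"
    and \<phi> \<theta> :: "complex \<Rightarrow> real \<Rightarrow> complex"
    and m :: "complex \<Rightarrow> complex"
    and ev :: "nat \<Rightarrow> complex"
    and f :: "real \<Rightarrow> complex"
  assumes "0 < q" and "q < 1"
    and "phi_family q V \<alpha> \<phi>"
    and "theta_family q V \<alpha> \<theta>"
    and "weyl_m_function q \<phi> \<theta> m"
    and "only_real_poles m"
    and "bij_betw ev UNIV {z. is_pole m z}"
    and "f \<in> Lq2_space q V \<alpha> \<phi> \<theta> m"
  shows "(\<lambda>n. (fourier_coeff q \<phi> m ev f n)\<^sup>2) sums jackson_integral q (\<lambda>x. (f x)\<^sup>2)"
proof -
  obtain N :: "nat \<Rightarrow> int" and \<beta> where N: "filterlim N at_bot sequentially"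
    and lim: "\<And>z. z \<notin> \<real> \<Longrightarrow> (\<lambda>j. weyl_l q \<phi> \<theta> z (q powi N j) (\<beta> j)) \<longlonglongrightarrow> m z"
    using weyl_m_function_lattice[OF assms(5,1,2)] by blast
  interpret q_lattice q "\<lambda>n. V (q powi n)"
    by standard (use assms in auto)
  interpret q_weyl_enum q "\<lambda>n. V (q powi n)" \<alpha> "\<lambda>z n. \<phi> z (q powi n)" "\<lambda>z n. \<theta> z (q powi n)" m N \<beta> ev
  proof
    fix z
    from assms(3) have p: "is_solution q V z (\<phi> z)" "has_initial_values q (\<phi> z)
            (complex_of_real (sqrt q / (1 - q) * sin \<alpha>)) (complex_of_real (- (sqrt q / (1 - q)) * cos \<alpha>))"
      by (auto simp: phi_family_def)
    from assms(4) have t: "is_solution q V z (\<theta> z)" "has_initial_values q (\<theta> z)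
            (complex_of_real (sqrt q / (1 - q) * cos \<alpha>)) (complex_of_real (sqrt q / (1 - q) * sin \<alpha>))"
      by (auto simp: theta_family_def)
    show "solves z (\<lambda>n. \<phi> z (q powi n))" by (rule solves_of_is_solution[OF p(1) refl])
    show "solves z (\<lambda>n. \<theta> z (q powi n))" by (rule solves_of_is_solution[OF t(1) refl])
    show "initial_values (\<lambda>n. \<phi> z (q powi n)) (of_real (sqrt q / (1 - q) * sin \<alpha>)) (of_real (- (sqrt q / (1 - q)) * cos \<alpha>))"
      by (rule initial_values_of_has_initial_values[OF p(2)])
    show "initial_values (\<lambda>n. \<theta> z (q powi n)) (of_real (sqrt q / (1 - q) * cos \<alpha>)) (of_real (sqrt q / (1 - q) * sin \<alpha>))"
      by (rule initial_values_of_has_initial_values[OF t(2)])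
    show "filterlim N at_bot sequentially" by (rule N)
    show "m meromorphic_on UNIV" using assms(6) by (simp add: only_real_poles_def)
    show "bij_betw ev UNIV {z. is_pole m z}" by (rule assms(7))
    {
      assume "z \<notin> \<real>"
      from lim[OF this] show "(\<lambda>j. - (boundary_form (\<beta> j) (N j) (\<lambda>n. \<theta> z (q powi n)) / boundary_form (\<beta> j) (N j) (\<lambda>n. \<phi> z (q powi n)))) \<longlonglongrightarrow> m z"
        unfolding weyl_l_lattice .
    }
    show "m analytic_on {z}" if "\<not> is_pole m z" using assms(6) that by (auto simp: only_real_poles_def)
    show "z \<in> \<real>" if "is_pole m z" using assms(6) that by (auto simp: only_real_poles_def)
  qed
  have eig: "eigenfun \<phi> m ev n (q powi k) = of_real (eigenvec n k)" for n k
  proof -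
    have "residue m (ev n) = of_real (Re (residue m (ev n)))" "0 \<le> Re (residue m (ev n))"
      using residue_real_nonneg[OF ev_pole, of n] by auto
    then have "csqrt (residue m (ev n)) = of_real (sqrt (Re (residue m (ev n))))"
      by (metis of_real_sqrt)
    moreover have "\<phi> (ev n) (q powi k) = of_real (Re (\<phi> (ev n) (q powi k)))"
      using phi_real[OF m_real_poles[OF ev_pole], of n k] by simp
    ultimately show ?thesis unfolding eigenfun_def eigenvec_def of_real_mult by metis
  qed
  have jackson: "jackson_integral q F = (\<Sum>\<^sub>\<infinity>k. of_real (weight k) * F (q powi k))" for F
    unfolding jackson_integral_def weight_def of_real_mult mult.assoc
    by (rule infsum_cmult_right'[symmetric])
  have "(\<lambda>k. weight k * (cmod (f (q powi k)))\<^sup>2) summable_on UNIV"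
  proof -
    have "(\<lambda>n::int. q powi n * (cmod (f (q powi n)))\<^sup>2) summable_on UNIV"
      using assms(8) by (simp add: Lq2_space_def L2q_def)
    from summable_on_cmult_right[OF this, of "1 - q"] show ?thesis
      by (simp add: weight_def mult.assoc)
  qed
  from eigenvec_parseval[OF this] show ?thesis
    unfolding fourier_coeff_def jackson eig .
qed

end
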